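(* For every $\epsilon>0$ there is some $N_\epsilon$ and a computable infinite $\{0,1\}$-valued sequence $a_1,a_2,a_3,\dots$ such that any two adjacent intervals of length $n>N_\epsilon$ differ in at least $(\frac12-\epsilon)n$ many places; that is, for each $k\ge 1$ and $n>N_\epsilon$, $a_{k+i}\neq a_{k+n+i}$ for at least $(\frac12-\epsilon)n$ many $i$ with $0\le i<n$. *)

theory Defs
  imports Complex_Main
begin

text \<open>
  Kleene's mu-recursive functions, as descriptions of partial functions together with a big-step
  evaluation relation on argument tuples, given as lists. Descriptions do not record arities;
  the length of the argument list fixes them. That no value is related to a
  tuple means that the function is undefined there. Primitive recursion and minimization act on
  the first argument; the step function of a primitive recursion receives the predecessor, then
  the previous value, then the parameters. Minimization requires all values below the zero to be
  defined.
\<close>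

datatype recf =
    Zero
  | Succ
  | Proj nat
  | Comp recf "recf list"
  | PrimRec recf recf
  | Mu recf

inductive evaluates :: "recf \<Rightarrow> nat list \<Rightarrow> nat \<Rightarrow> bool" where
  Zero: "evaluates Zero xs 0"
| Succ: "evaluates Succ [x] (Suc x)"
| Proj: "i < length xs \<Longrightarrow> evaluates (Proj i) xs (xs ! i)"
| Comp: "list_all2 (\<lambda>g y. evaluates g xs y) gs ys \<Longrightarrow> evaluates f ys z
         \<Longrightarrow> evaluates (Comp f gs) xs z"
| PrimRec_0: "evaluates f xs y \<Longrightarrow> evaluates (PrimRec f g) (0 # xs) y"
| PrimRec_Suc: "evaluates (PrimRec f g) (n # xs) r \<Longrightarrow> evaluates g (n # r # xs) y
         \<Longrightarrow> evaluates (PrimRec f g) (Suc n # xs) y"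
| Mu: "evaluates f (n # xs) 0 \<Longrightarrow> (\<And>m. m < n \<Longrightarrow> \<exists>y. evaluates f (m # xs) (Suc y))
         \<Longrightarrow> evaluates (Mu f) xs n"

inductive_cases evaluates_cases:
  "evaluates Zero xs y"
  "evaluates Succ xs y"
  "evaluates (Proj i) xs y"
  "evaluates (Comp f gs) xs y"
  "evaluates (PrimRec f g) (0 # xs) y"
  "evaluates (PrimRec f g) (Suc n # xs) y"
  "evaluates (Mu f) xs y"

lemma evaluates_deterministic:
  "evaluates p xs y \<Longrightarrow> evaluates p xs z \<Longrightarrow> y = z"
proof (induction arbitrary: z rule: evaluates.induct)
  case (Zero xs)
  then show ?case by (elim evaluates_cases) simp
next
  case (Succ x)
  then show ?case by (elim evaluates_cases) simp
next
  case (Proj i xs)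
  then show ?case by (elim evaluates_cases) simp
next
  case (Comp xs gs ys f w)
  from Comp.prems obtain ys' where ys': "list_all2 (\<lambda>g y. evaluates g xs y) gs ys'"
    and f: "evaluates f ys' z"
    by (rule evaluates_cases)
  have "ys = ys'"
  proof (rule nth_equalityI)
    show "length ys = length ys'"
      using Comp.IH(1) ys' by (simp add: list_all2_conv_all_nth)
  next
    fix i assume "i < length ys"
    then show "ys ! i = ys' ! i"
      using Comp.IH(1) ys' unfolding list_all2_conv_all_nth by metis
  qed
  with Comp.IH(2) f show ?case by blast
next
  case (PrimRec_0 f xs y g)
  from PrimRec_0.prems have "evaluates f xs z" by (rule evaluates_cases)
  with PrimRec_0.IH show ?case by blast
next
  case (PrimRec_Suc f g n xs r y)
  from PrimRec_Suc.prems obtain r' where "evaluates (PrimRec f g) (n # xs) r'"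
    and "evaluates g (n # r' # xs) z"
    by (rule evaluates_cases)
  with PrimRec_Suc.IH show ?case by blast
next
  case (Mu f n xs)
  from Mu.prems have z: "evaluates f (z # xs) 0"
    and below: "\<And>m. m < z \<Longrightarrow> \<exists>y. evaluates f (m # xs) (Suc y)"
    by (rule evaluates_cases; blast)+
  have "\<not> z < n" using Mu.IH(2) z by (metis nat.distinct(1))
  moreover have "\<not> n < z" using Mu.IH(1) below by (metis nat.distinct(1))
  ultimately show ?case by simp
qed

definition computable :: "(nat \<Rightarrow> nat) \<Rightarrow> bool" where
  "computable f \<longleftrightarrow> (\<exists>p. \<forall>n. evaluates p [n] (f n))"

end

theory Submission
  imports Defs "HOL-Analysis.Analysis"
begin

text \<open>
  No random construction is needed: the sequence $a_k = \lfloor 2\sqrt{2}\,k^3 \rfloor \bmod 2$ works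
  for all $\epsilon$ at once, and it is computable because $\lfloor 2\sqrt{2}\,k^3 \rfloor$ is the
  integer square root of $8k^6$. The sign $(-1)^{a_k}$ is the sign of $\sin \varphi_k$ with
  $\varphi_k = 2\sqrt{2}\,\pi k^3$. It is approximated by an odd trigonometric polynomial in
  $\varphi_k$, with an error at most $\cos^{2m} \varphi_k$, whose mean is small. The claim thereby
  reduces to cancellation in the sums of $e^{i(a\varphi_{k+j} + b\varphi_{k+n+j})}$ over $j < n$, uniformly
  in $k$. If $a + b \neq 0$ the phase is a cubic with a fixed irrational leading coefficient, and van
  der Corput differencing applies. If $a + b = 0$ it is a quadratic whose leading coefficient
  $-6\sqrt{2}\,\pi a n$ grows with $n$ and may come as close as order $1/n$ to a multiple of $\pi$; one
  differencing step still suffices, since $\sqrt{2}$ is badly approximable and hence only few of the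
  boundedly many shifts can be resonant.
\<close>

section \<open>Van der Corput differencing\<close>

lemma half_le_sin:
  fixes x :: real
  assumes "0 \<le> x" "x \<le> pi / 2"
  shows "x / 2 \<le> sin x"
proof -
  have "\<bar>sin x - (\<Sum>m<3. sin_coeff m * x ^ m)\<bar> \<le> inverse (fact 3) * \<bar>x\<bar> ^ 3"
    by (rule Maclaurin_sin_bound)
  then have *: "\<bar>sin x - x\<bar> \<le> x ^ 3 / 6"
    using assms by (simp add: sin_coeff_def eval_nat_numeral field_simps)
  \<comment> \<open>1.6 exceeds \<open>pi / 2\<close> and its square is below 3, which is what turns
    the error \<open>x ^ 3 / 6\<close> into at most \<open>x / 2\<close>.\<close>
  have "x \<le> 1.6" using assms pi_less_4 pi_approx by simp
  then have "x ^ 2 \<le> 1.6 ^ 2" using assms by (intro power_mono) auto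
  then have "x * x ^ 2 \<le> x * 3" using assms by (intro mult_left_mono) (auto simp: power2_eq_square)
  then have "x ^ 3 / 6 \<le> x / 2" by (simp add: power3_eq_cube power2_eq_square)
  then show ?thesis using * by linarith
qed

text \<open>Removing the nearest integer changes the sine only by a sign, and for the remainder the
  linear bound above applies because it is at most 1/2. This turns a small sine into a statement
  about distances to integers.\<close>

lemma abs_sin_pi_ge_dist_int:
  fixes x :: real
  shows "\<bar>x - of_int (round x)\<bar> \<le> \<bar>sin (pi * x)\<bar>"
proof -
  define b where "b = round x"
  define r where "r = x - of_int b"
  have r: "\<bar>r\<bar> \<le> 1 / 2" using of_int_round_abs_le[of x] by (simp add: r_def b_def abs_minus_commute)
  have "sin (pi * x) = sin (pi * r + pi * of_int b)" by (simp add: r_def algebra_simps)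
  also have "\<dots> = sin (pi * r) * cos (pi * of_int b)" by (simp add: sin_add)
  finally have "\<bar>sin (pi * x)\<bar> = \<bar>sin (pi * r)\<bar>" by (simp add: abs_mult)
  also have "\<bar>sin (pi * r)\<bar> = \<bar>sin (pi * \<bar>r\<bar>)\<bar>" by (simp add: abs_if)
  also have "\<dots> \<ge> pi * \<bar>r\<bar> / 2"
    using half_le_sin[of "pi * \<bar>r\<bar>"] mult_left_mono[OF r, of pi] by simp
  finally have "pi * \<bar>r\<bar> / 2 \<le> \<bar>sin (pi * x)\<bar>" .
  moreover have "2 * \<bar>r\<bar> \<le> pi * \<bar>r\<bar>" using pi_gt3 by (intro mult_right_mono) auto
  ultimately show ?thesis by (simp add: r_def b_def)
qed

text \<open>The norm \<open>2 * q ^ 2 - p ^ 2\<close> is a nonzero integer, so its two conjugate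
  factors cannot both be small: a very small first factor would force the second below
  \<open>4 * q\<close> and the product below 1.\<close>

lemma sqrt2_badly_approximable:
  fixes q :: nat and p :: int
  assumes "q > 0"
  shows "1 / (4 * real q) \<le> \<bar>sqrt 2 * real q - of_int p\<bar>"
proof (rule ccontr)
  assume "\<not> ?thesis"
  then have less: "\<bar>sqrt 2 * real q - of_int p\<bar> < 1 / (4 * real q)" by simp
  \<comment> \<open>The exponent of 2 is odd on the left and even on the right.\<close>
  have "2 * int q ^ 2 \<noteq> p ^ 2"
  proof
    assume eq: "2 * int q ^ 2 = p ^ 2"
    have "multiplicity 2 (p ^ 2) = 2 * multiplicity 2 p"
      using eq assms by (intro prime_elem_multiplicity_power_distrib) auto
    moreover have "multiplicity 2 (2 * int q ^ 2) = 1 + 2 * multiplicity 2 (int q)"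
      using assms by (simp add: prime_elem_multiplicity_mult_distrib prime_elem_multiplicity_power_distrib)
    moreover have "multiplicity 2 (2 * int q ^ 2) = multiplicity 2 (p ^ 2)" by (simp only: eq)
    ultimately have "2 * multiplicity 2 p = 1 + 2 * multiplicity 2 (int q)" by linarith
    then show False by presburger
  qed
  then have "1 \<le> \<bar>2 * int q ^ 2 - p ^ 2\<bar>" by linarith
  then have "real_of_int 1 \<le> real_of_int \<bar>2 * int q ^ 2 - p ^ 2\<bar>" by (simp only: of_int_le_iff)
  then have "1 \<le> \<bar>2 * real q ^ 2 - of_int p ^ 2\<bar>" by simp
  also have "2 * real q ^ 2 - of_int p ^ 2 = (sqrt 2 * real q - of_int p) * (sqrt 2 * real q + of_int p)"
    by (simp add: algebra_simps power2_eq_square)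
  also have "\<bar>\<dots>\<bar> = \<bar>sqrt 2 * real q - of_int p\<bar> * \<bar>sqrt 2 * real q + of_int p\<bar>"
    by (simp add: abs_mult)
  \<comment> \<open>The conjugate factor is at most \<open>3 * q + 1 / 4\<close>, hence at most
    \<open>4 * q - 1 / 2\<close> since \<open>q \<ge> 1\<close>; the subtracted 1/2 makes the
    product strictly less than 1.\<close>
  also have "\<dots> \<le> 1 / (4 * real q) * (4 * real q - 1 / 2)"
  proof (rule mult_mono)
    have "sqrt 2 \<le> 1.5" by (rule real_le_lsqrt) (auto simp: power2_eq_square)
    then have "sqrt 2 * real q \<le> 1.5 * real q" by (intro mult_right_mono) auto
    moreover have "1 / (4 * real q) \<le> 1 / 4" using assms by (simp add: field_simps)
    moreover have "\<bar>sqrt 2 * real q + of_int p\<bar> \<le> 2 * (sqrt 2 * real q) + \<bar>sqrt 2 * real q - of_int p\<bar>"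
    proof -
      have "0 \<le> sqrt 2 * real q" by simp
      then show ?thesis by linarith
    qed
    moreover have "real q \<ge> 1" using assms by simp
    ultimately show "\<bar>sqrt 2 * real q + of_int p\<bar> \<le> 4 * real q - 1 / 2"
      using less by linarith
  qed (use less in auto)
  also have "\<dots> < 1" using assms by (simp add: field_simps)
  finally show False by simp
qed

section \<open>Geometric sums and van der Corput's inequality\<close>

lemma norm_sum_cis_linear_le:
  fixes x y :: real
  assumes "sin (x / 2) \<noteq> 0"
  shows "norm (\<Sum>i<n. cis (x * real i + y)) \<le> 1 / \<bar>sin (x / 2)\<bar>"
proof -
  have d: "norm (cis x - 1) = 2 * \<bar>sin (x / 2)\<bar>"
    using dist_exp_i_1[of x] by (simp add: cis_conv_exp)
  then have ne: "cis x \<noteq> 1" using assms by auto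
  have "(\<Sum>i<n. cis (x * real i + y)) = cis y * (\<Sum>i<n. cis x ^ i)"
    unfolding sum_distrib_left
    by (intro sum.cong refl) (simp add: Complex.DeMoivre cis_mult algebra_simps)
  also have "\<dots> = cis y * ((cis x ^ n - 1) / (cis x - 1))"
    using ne by (simp add: geometric_sum)
  finally have "norm (\<Sum>i<n. cis (x * real i + y)) = norm (cis x ^ n - 1) / (2 * \<bar>sin (x / 2)\<bar>)"
    by (simp only: norm_mult norm_divide d norm_cis mult_1)
  also have "\<dots> \<le> 2 / (2 * \<bar>sin (x / 2)\<bar>)"
    using norm_triangle_ineq4[of "cis x ^ n" 1] by (intro divide_right_mono) (auto simp: norm_power)
  finally show ?thesis by simp
qed

text \<open>Each unit shift of the window exchanges one term for another, at a cost of at most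
  2.\<close>

lemma norm_sum_shift_diff_le:
  fixes f :: "nat \<Rightarrow> complex"
  assumes "\<And>i. norm (f i) \<le> 1"
  shows "norm ((\<Sum>i<n. f i) - (\<Sum>i<n. f (i + h))) \<le> 2 * real h"
proof (induction h)
  case (Suc h)
  have "(\<Sum>i<n. f (i + h)) - (\<Sum>i<n. f (i + Suc h)) = f h - f (n + h)"
    using sum_lessThan_telescope'[of "\<lambda>i. f (i + h)" n] by (simp add: sum_subtractf)
  then have "norm ((\<Sum>i<n. f i) - (\<Sum>i<n. f (i + Suc h)))
      = norm ((\<Sum>i<n. f i) - (\<Sum>i<n. f (i + h)) + (f h - f (n + h)))"
    by (simp add: algebra_simps)
  also have "\<dots> \<le> 2 * real h + norm (f h - f (n + h))"
    using Suc by (intro norm_triangle_le add_right_mono)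
  also have "norm (f h - f (n + h)) \<le> 2"
    using norm_triangle_ineq4[of "f h" "f (n + h)"] assms[of h] assms[of "n + h"] by linarith
  finally show ?case by simp
qed simp

text \<open>\<open>H\<close> times the sum is nearly the sum \<open>T\<close> over \<open>H\<close>
  shifted windows. Cauchy-Schwarz over \<open>i\<close> and expansion of the square over
  \<open>h\<close> bound \<open>T\<close> by the shift correlations. Since \<open>f\<close> is
  defined on all of \<open>nat\<close>, every correlation runs over the same range
  \<open>i < n\<close>.\<close>

lemma van_der_Corput_inequality:
  fixes f :: "nat \<Rightarrow> complex"
  assumes f: "\<And>i. norm (f i) \<le> 1"
  shows "real H * norm (\<Sum>i<n. f i)
    \<le> sqrt (real n * (\<Sum>h<H. \<Sum>h'<H. norm (\<Sum>i<n. f (i + h) * cnj (f (i + h'))))) + 2 * (real H)\<^sup>2"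
proof -
  define S where "S = (\<Sum>i<n. f i)"
  define T where "T = (\<Sum>i<n. \<Sum>h<H. f (i + h))"
  have "of_nat H * S - T = (\<Sum>h<H. S - (\<Sum>i<n. f (i + h)))"
    unfolding T_def by (subst sum.swap) (simp add: sum_subtractf)
  then have "norm (of_nat H * S - T) \<le> (\<Sum>h<H. norm (S - (\<Sum>i<n. f (i + h))))"
    by (metis norm_sum)
  also have "\<dots> \<le> (\<Sum>h<H. 2 * real H)"
  proof (rule sum_mono)
    fix h assume "h \<in> {..<H}"
    then show "norm (S - (\<Sum>i<n. f (i + h))) \<le> 2 * real H"
      using norm_sum_shift_diff_le[of f, OF f, of n h] by (simp add: S_def)
  qed
  finally have 1: "norm (of_nat H * S - T) \<le> 2 * (real H)\<^sup>2" by (simp add: power2_eq_square)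
  have "(norm T)\<^sup>2 \<le> (\<Sum>i<n. norm (\<Sum>h<H. f (i + h)))\<^sup>2"
    unfolding T_def by (intro power_mono norm_sum norm_ge_zero)
  also have "\<dots> \<le> (\<Sum>i<n. (norm (\<Sum>h<H. f (i + h)))\<^sup>2) * real n"
    using sum_squared_le_sum_of_squares[of "\<lambda>i. norm (\<Sum>h<H. f (i + h))" "{..<n}"]
    by (simp add: mult.commute)
  finally have T: "(norm T)\<^sup>2 \<le> (\<Sum>i<n. (norm (\<Sum>h<H. f (i + h)))\<^sup>2) * real n" .
  \<comment> \<open>The sum of squares is written as the norm of a complex sum, so that the triangle
    inequality can be delayed until the sum over \<open>i\<close> is innermost and its cancellation
    is kept.\<close>
  have "(\<Sum>i<n. (norm (\<Sum>h<H. f (i + h)))\<^sup>2)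
      = norm (\<Sum>i<n. (\<Sum>h<H. f (i + h)) * cnj (\<Sum>h<H. f (i + h)))"
  proof -
    have "complex_of_real (\<Sum>i<n. (norm (\<Sum>h<H. f (i + h)))\<^sup>2)
        = (\<Sum>i<n. (\<Sum>h<H. f (i + h)) * cnj (\<Sum>h<H. f (i + h)))"
      by (simp only: of_real_sum complex_norm_square)
    moreover have "norm (complex_of_real (\<Sum>i<n. (norm (\<Sum>h<H. f (i + h)))\<^sup>2))
        = (\<Sum>i<n. (norm (\<Sum>h<H. f (i + h)))\<^sup>2)"
      by (simp only: norm_of_real) (simp add: sum_nonneg)
    ultimately show ?thesis by simp
  qed
  also have "(\<Sum>i<n. (\<Sum>h<H. f (i + h)) * cnj (\<Sum>h<H. f (i + h)))
      = (\<Sum>i<n. \<Sum>h<H. \<Sum>h'<H. f (i + h) * cnj (f (i + h')))"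
    by (simp add: cnj_sum sum_product)
  also have "\<dots> = (\<Sum>h<H. \<Sum>h'<H. \<Sum>i<n. f (i + h) * cnj (f (i + h')))"
    by (subst sum.swap, rule sum.cong[OF refl], rule sum.swap)
  also have "norm \<dots> \<le> (\<Sum>h<H. \<Sum>h'<H. norm (\<Sum>i<n. f (i + h) * cnj (f (i + h'))))"
    by (rule order_trans[OF norm_sum], rule sum_mono, rule norm_sum)
  finally have "(\<Sum>i<n. (norm (\<Sum>h<H. f (i + h)))\<^sup>2) * real n
      \<le> (\<Sum>h<H. \<Sum>h'<H. norm (\<Sum>i<n. f (i + h) * cnj (f (i + h')))) * real n"
    by (rule mult_right_mono) simp
  with T have "(norm T)\<^sup>2 \<le> real n * (\<Sum>h<H. \<Sum>h'<H. norm (\<Sum>i<n. f (i + h) * cnj (f (i + h'))))"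
    by (subst mult.commute) (rule order_trans)
  then have 2: "norm T \<le> sqrt (real n * (\<Sum>h<H. \<Sum>h'<H. norm (\<Sum>i<n. f (i + h) * cnj (f (i + h')))))"
    by (rule real_le_rsqrt)
  have "real H * norm S = norm (of_nat H * S)" by (simp add: norm_mult)
  also have "\<dots> \<le> norm T + norm (of_nat H * S - T)"
    by (rule norm_triangle_sub)
  finally have "real H * norm S \<le> norm T + norm (of_nat H * S - T)" .
  then show ?thesis using 1 2 unfolding S_def by linarith
qed

text \<open>The exceptional pairs are few and each contributes at most \<open>n\<close>; each
  remaining pair contributes at most \<open>\<eta> * n\<close>. Both groups give at most
  \<open>\<eta> * H ^ 2 * n\<close>, whence the factor 2 under the root. Tolerating exceptional
  pairs is what later admits resonant shifts.\<close>

lemma norm_sum_le_of_few_correlated_shifts: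
  fixes f :: "nat \<Rightarrow> complex"
  assumes f: "\<And>i. norm (f i) \<le> 1" and "H > 0" "\<eta> \<ge> 0"
    and few: "real (card {(h, h'). h < H \<and> h' < H \<and>
      \<eta> * real n < norm (\<Sum>i<n. f (i + h) * cnj (f (i + h')))}) \<le> \<eta> * (real H)\<^sup>2"
  shows "norm (\<Sum>i<n. f i) \<le> sqrt (2 * \<eta>) * real n + 2 * real H"
proof -
  define C where "C = (\<lambda>(h, h'). norm (\<Sum>i<n. f (i + h) * cnj (f (i + h'))))"
  define B where "B = {(h, h'). h < H \<and> h' < H \<and> \<eta> * real n < C (h, h')}"
  define A where "A = {..<H} \<times> {..<H}"
  have BA: "B \<subseteq> A" and finA: "finite A" by (auto simp: A_def B_def)
  have C_le: "C z \<le> real n" for z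
  proof -
    obtain h h' where z: "z = (h, h')" by fastforce
    have "C z \<le> (\<Sum>i<n. norm (f (i + h) * cnj (f (i + h'))))"
      unfolding C_def z by (simp add: norm_sum)
    also have "\<dots> \<le> (\<Sum>i<n. 1)"
      by (intro sum_mono) (simp add: norm_mult mult_le_one f)
    finally show ?thesis by simp
  qed
  have "(\<Sum>h<H. \<Sum>h'<H. norm (\<Sum>i<n. f (i + h) * cnj (f (i + h')))) = sum C A"
    by (simp add: C_def A_def sum.cartesian_product)
  also have "\<dots> = sum C B + sum C (A - B)"
    using BA finA by (metis sum.subset_diff add.commute)
  also have "sum C B \<le> real (card B) * real n"
    using sum_bounded_above[of B C "real n"] C_le by simp
  also have "\<dots> \<le> \<eta> * (real H)\<^sup>2 * real n"
    using few by (intro mult_right_mono) (auto simp: B_def C_def)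
  also have "sum C (A - B) \<le> real (card (A - B)) * (\<eta> * real n)"
    by (rule sum_bounded_above) (auto simp: A_def B_def not_less)
  also have "\<dots> \<le> (real H)\<^sup>2 * (\<eta> * real n)"
  proof (rule mult_right_mono)
    have "card (A - B) \<le> card A" using finA by (intro card_mono) auto
    then show "real (card (A - B)) \<le> (real H)\<^sup>2"
      by (simp add: A_def power2_eq_square flip: of_nat_mult)
  qed (use assms in auto)
  finally have "real n * (\<Sum>h<H. \<Sum>h'<H. norm (\<Sum>i<n. f (i + h) * cnj (f (i + h'))))
      \<le> real n * (2 * \<eta> * (real H)\<^sup>2 * real n)"
    by (intro mult_left_mono) (auto simp: algebra_simps)
  also have "\<dots> = (2 * \<eta>) * (real H * real n)\<^sup>2" by (simp add: power2_eq_square)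
  finally have "sqrt (real n * (\<Sum>h<H. \<Sum>h'<H. norm (\<Sum>i<n. f (i + h) * cnj (f (i + h')))))
      \<le> sqrt ((2 * \<eta>) * (real H * real n)\<^sup>2)"
    by (rule real_sqrt_le_mono)
  also have "\<dots> = sqrt (2 * \<eta>) * (real H * real n)"
    unfolding real_sqrt_mult by simp
  finally have "sqrt (real n * (\<Sum>h<H. \<Sum>h'<H. norm (\<Sum>i<n. f (i + h) * cnj (f (i + h')))))
      \<le> sqrt (2 * \<eta>) * (real H * real n)" .
  then have "real H * norm (\<Sum>i<n. f i) \<le> sqrt (2 * \<eta>) * (real H * real n) + 2 * (real H)\<^sup>2"
    using van_der_Corput_inequality[of f H n, OF f] by linarith
  also have "\<dots> = real H * (sqrt (2 * \<eta>) * real n + 2 * real H)"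
    by (simp add: power2_eq_square algebra_simps)
  finally show ?thesis using \<open>H > 0\<close> by simp
qed

section \<open>Quadratic and cubic exponential sums\<close>

text \<open>Correlating two shifts of a quadratic phase leaves a linear phase of frequency
  \<open>2 * \<gamma> * (h - h')\<close>, that is, a geometric sum. The condition on pairs is a
  product, so that a vanishing sine counts as exceptional without any division. It involves neither
  \<open>\<delta>\<close> nor \<open>\<kappa>\<close>, hence the uniformity in them.\<close>

lemma norm_sum_cis_quadratic_le:
  fixes \<gamma> \<delta> \<kappa> :: real
  assumes "H > 0" "\<eta> > 0"
    and few: "real (card {(h, h'). h < H \<and> h' < H \<and>
      \<bar>sin (\<gamma> * (real h - real h'))\<bar> * (\<eta> * real n) < 1}) \<le> \<eta> * (real H)\<^sup>2"
  shows "norm (\<Sum>i<n. cis (\<gamma> * real i ^ 2 + \<delta> * real i + \<kappa>)) \<le> sqrt (2 * \<eta>) * real n + 2 * real H"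
proof (rule norm_sum_le_of_few_correlated_shifts)
  define f where "f = (\<lambda>i. cis (\<gamma> * real i ^ 2 + \<delta> * real i + \<kappa>))"
  have "\<eta> * real n < norm (\<Sum>i<n. f (i + h) * cnj (f (i + h')))
      \<Longrightarrow> \<bar>sin (\<gamma> * (real h - real h'))\<bar> * (\<eta> * real n) < 1" for h h'
  proof (rule ccontr)
    assume less: "\<eta> * real n < norm (\<Sum>i<n. f (i + h) * cnj (f (i + h')))"
      and "\<not> \<bar>sin (\<gamma> * (real h - real h'))\<bar> * (\<eta> * real n) < 1"
    then have ge: "1 \<le> \<bar>sin (\<gamma> * (real h - real h'))\<bar> * (\<eta> * real n)" by simp
    define x where "x = 2 * \<gamma> * (real h - real h')"
    have s: "sin (x / 2) = sin (\<gamma> * (real h - real h'))" by (simp add: x_def)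
    have nz: "sin (x / 2) \<noteq> 0" using ge s by auto
    have "f (i + h) * cnj (f (i + h'))
        = cis (x * real i + (\<gamma> * (real h ^ 2 - real h' ^ 2) + \<delta> * (real h - real h')))" for i
      by (simp add: f_def x_def cis_cnj cis_mult) (simp add: algebra_simps power2_eq_square)
    then have "norm (\<Sum>i<n. f (i + h) * cnj (f (i + h'))) \<le> 1 / \<bar>sin (x / 2)\<bar>"
      using norm_sum_cis_linear_le[OF nz] by simp
    also have "\<dots> \<le> \<eta> * real n" using ge nz by (simp add: s field_simps)
    finally show False using less by simp
  qed
  then have "card {(h, h'). h < H \<and> h' < H \<and> \<eta> * real n < norm (\<Sum>i<n. f (i + h) * cnj (f (i + h')))}
      \<le> card {(h, h'). h < H \<and> h' < H \<and> \<bar>sin (\<gamma> * (real h - real h'))\<bar> * (\<eta> * real n) < 1}"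
    by (intro card_mono) (auto intro: finite_subset[of _ "{..<H} \<times> {..<H}"])
  then show "real (card {(h, h'). h < H \<and> h' < H \<and>
      \<eta> * real n < norm (\<Sum>i<n. f (i + h) * cnj (f (i + h')))}) \<le> \<eta> * (real H)\<^sup>2"
    using few by simp
qed (use assms in auto)

text \<open>In the absence of resonance only the pairs with \<open>h = h'\<close> are exceptional, a
  proportion of \<open>1 / H\<close>.\<close>

lemma few_diagonal:
  assumes "\<And>h h'. (h, h') \<in> B \<Longrightarrow> h = h' \<and> h < H" and "1 \<le> \<eta> * real H"
  shows "real (card B) \<le> \<eta> * (real H)\<^sup>2"
proof -
  have "B \<subseteq> (\<lambda>h. (h, h)) ` {..<H}" using assms(1) by fastforce
  then have "card B \<le> card ((\<lambda>h. (h, h)) ` {..<H})" by (intro card_mono) auto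
  also have "\<dots> \<le> H" using card_image_le[of "{..<H}" "\<lambda>h. (h, h)"] by simp
  finally have "real (card B) \<le> real H" by simp
  also have "\<dots> \<le> \<eta> * real H * real H"
    using mult_right_mono[OF assms(2), of "real H"] by simp
  finally show ?thesis by (simp add: power2_eq_square)
qed

lemma eventually_le_mult_real:
  fixes c \<eta> :: real
  assumes "\<eta> > 0"
  shows "\<forall>\<^sub>F n in sequentially. c \<le> \<eta> * real n"
proof -
  have "filterlim (\<lambda>n. \<eta> * real n) at_top sequentially"
    using assms by (intro filterlim_tendsto_pos_mult_at_top[OF tendsto_const] filterlim_real_sequentially)
  then show ?thesis by (simp add: filterlim_at_top)
qed

lemma ex_nat_ge_mult:
  fixes c \<eta> :: real
  assumes "\<eta> > 0"
  obtains H :: nat where "H > 0" "c \<le> \<eta> * real H"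
proof -
  obtain H :: nat where "H > 0 \<and> c \<le> \<eta> * real H"
    using eventually_conj[OF eventually_gt_at_top[of 0] eventually_le_mult_real[OF assms, of c]]
    by (metis (mono_tags, lifting) eventually_happens trivial_limit_sequentially)
  then show ?thesis using that by blast
qed

lemma sqrt_double_eighth_square: "\<eta> > 0 \<Longrightarrow> sqrt (2 * (\<eta>\<^sup>2 / 8)) = \<eta> / (2 :: real)"
  by (simp add: real_sqrt_divide)

lemma sin_mult_diff_nonzero:
  fixes \<gamma> :: real
  assumes nz: "\<And>d::nat. d > 0 \<Longrightarrow> sin (\<gamma> * real d) \<noteq> 0" and "h \<noteq> h'"
  shows "sin (\<gamma> * (real h - real h')) \<noteq> 0"
proof (cases "h < h'")
  case True
  then have "\<gamma> * (real h - real h') = - (\<gamma> * real (h' - h))"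
    by (simp add: of_nat_diff algebra_simps)
  then show ?thesis using nz[of "h' - h"] True by simp
next
  case False
  then have "\<gamma> * (real h - real h') = \<gamma> * real (h - h')"
    by (simp add: of_nat_diff)
  then show ?thesis using nz[of "h - h'"] False assms(2) by simp
qed

text \<open>\<open>H\<close> depends on \<open>\<eta>\<close> alone, so for fixed
  \<open>\<gamma>\<close> only finitely many sines occur off the diagonal. They are nonzero, and for
  large \<open>n\<close> all of them clear the threshold \<open>1 / (\<rho> * n)\<close>.\<close>

lemma eventually_norm_sum_cis_quadratic_le:
  fixes \<gamma> :: real
  assumes nz: "\<And>d::nat. d > 0 \<Longrightarrow> sin (\<gamma> * real d) \<noteq> 0" and "\<eta> > 0"
  shows "\<forall>\<^sub>F n in sequentially. \<forall>\<delta> \<kappa>.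
    norm (\<Sum>i<n. cis (\<gamma> * real i ^ 2 + \<delta> * real i + \<kappa>)) \<le> \<eta> * real n"
proof -
  \<comment> \<open>With this choice the main term is \<open>\<eta> / 2 * n\<close>; the other half
    of the bound absorbs \<open>2 * H\<close>.\<close>
  define \<rho> where "\<rho> = \<eta>\<^sup>2 / 8"
  have \<rho>: "\<rho> > 0" "sqrt (2 * \<rho>) = \<eta> / 2"
    using assms(2) sqrt_double_eighth_square by (auto simp: \<rho>_def)
  obtain H :: nat where H: "H > 0" "1 \<le> \<rho> * real H"
    using ex_nat_ge_mult[OF \<rho>(1)] .
  have "\<forall>\<^sub>F n in sequentially. \<forall>z\<in>{..<H}\<times>{..<H}. fst z \<noteq> snd z \<longrightarrow>
      1 \<le> \<bar>sin (\<gamma> * (real (fst z) - real (snd z)))\<bar> * \<rho> * real n"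
  proof (intro eventually_ball_finite ballI)
    fix z
    show "\<forall>\<^sub>F n in sequentially. fst z \<noteq> snd z \<longrightarrow>
      1 \<le> \<bar>sin (\<gamma> * (real (fst z) - real (snd z)))\<bar> * \<rho> * real n"
    proof (cases "fst z = snd z")
      case False
      then have "0 < \<bar>sin (\<gamma> * (real (fst z) - real (snd z)))\<bar> * \<rho>"
        using sin_mult_diff_nonzero[OF nz False] \<rho> by simp
      from eventually_le_mult_real[OF this, of 1] show ?thesis by eventually_elim simp
    qed simp
  qed simp
  moreover have "\<forall>\<^sub>F n in sequentially. 2 * real H \<le> \<eta> / 2 * real n"
    using assms(2) by (intro eventually_le_mult_real) simp
  ultimately show ?thesis
  proof eventually_elim
    case (elim n)
    show ?case
    proof (intro allI)
      fix \<delta> \<kappa>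
      have "norm (\<Sum>i<n. cis (\<gamma> * real i ^ 2 + \<delta> * real i + \<kappa>)) \<le> sqrt (2 * \<rho>) * real n + 2 * real H"
      proof (rule norm_sum_cis_quadratic_le)
        show "real (card {(h, h'). h < H \<and> h' < H \<and>
            \<bar>sin (\<gamma> * (real h - real h'))\<bar> * (\<rho> * real n) < 1}) \<le> \<rho> * (real H)\<^sup>2"
        proof (rule few_diagonal)
          fix h h'
          assume "(h, h') \<in> {(h, h'). h < H \<and> h' < H \<and>
            \<bar>sin (\<gamma> * (real h - real h'))\<bar> * (\<rho> * real n) < 1}"
          then show "h = h' \<and> h < H" using elim(1) by (force simp: mult.assoc)
        qed (fact H)
      qed (use H \<rho> in auto)
      also have "\<dots> \<le> \<eta> * real n" using elim(2) unfolding \<rho>(2) by simp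
      finally show "norm (\<Sum>i<n. cis (\<gamma> * real i ^ 2 + \<delta> * real i + \<kappa>)) \<le> \<eta> * real n" .
    qed
  qed
qed

text \<open>Correlating shifts of the cubic gives a quadratic whose leading coefficient
  \<open>3 * \<theta> * (h - h')\<close> is fixed, while its lower coefficients depend on
  \<open>\<gamma>\<close> and \<open>\<delta>\<close>; the quadratic bound is uniform in
  these.\<close>

lemma eventually_norm_sum_cis_cubic_le:
  fixes \<theta> :: real
  assumes nz: "\<And>d::nat. d > 0 \<Longrightarrow> sin (\<theta> * real d) \<noteq> 0" and "\<eta> > 0"
  shows "\<forall>\<^sub>F n in sequentially. \<forall>\<gamma> \<delta> \<kappa>.
    norm (\<Sum>i<n. cis (\<theta> * real i ^ 3 + \<gamma> * real i ^ 2 + \<delta> * real i + \<kappa>)) \<le> \<eta> * real n"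
proof -
  define \<rho> where "\<rho> = \<eta>\<^sup>2 / 8"
  have \<rho>: "\<rho> > 0" "sqrt (2 * \<rho>) = \<eta> / 2"
    using assms(2) sqrt_double_eighth_square by (auto simp: \<rho>_def)
  obtain H :: nat where H: "H > 0" "1 \<le> \<rho> * real H"
    using ex_nat_ge_mult[OF \<rho>(1)] .
  have "\<forall>\<^sub>F n in sequentially. \<forall>z\<in>{..<H}\<times>{..<H}. fst z \<noteq> snd z \<longrightarrow> (\<forall>\<delta> \<kappa>.
      norm (\<Sum>i<n. cis (3 * \<theta> * (real (fst z) - real (snd z)) * real i ^ 2 + \<delta> * real i + \<kappa>)) \<le> \<rho> * real n)"
  proof (intro eventually_ball_finite ballI)
    fix z :: "nat \<times> nat"
    show "\<forall>\<^sub>F n in sequentially. fst z \<noteq> snd z \<longrightarrow> (\<forall>\<delta> \<kappa>.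
      norm (\<Sum>i<n. cis (3 * \<theta> * (real (fst z) - real (snd z)) * real i ^ 2 + \<delta> * real i + \<kappa>)) \<le> \<rho> * real n)"
    proof (cases "fst z = snd z")
      case False
      \<comment> \<open>The factors 3 and \<open>d\<close> are absorbed into the two integers whose
        difference multiplies \<open>\<theta>\<close>.\<close>
      have nz3: "sin (3 * \<theta> * (real (fst z) - real (snd z)) * real d) \<noteq> 0" if "d > 0" for d :: nat
      proof -
        have "3 * \<theta> * (real (fst z) - real (snd z)) * real d
            = \<theta> * (real (3 * d * fst z) - real (3 * d * snd z))"
          by (simp add: algebra_simps)
        moreover have "3 * d * fst z \<noteq> 3 * d * snd z" using that False by simp
        ultimately show ?thesis using sin_mult_diff_nonzero[of \<theta>, OF nz] by presburger
      qed
      have "\<forall>\<^sub>F n in sequentially. \<forall>\<delta> \<kappa>. norm (\<Sum>i<n.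
          cis (3 * \<theta> * (real (fst z) - real (snd z)) * real i ^ 2 + \<delta> * real i + \<kappa>)) \<le> \<rho> * real n"
        by (rule eventually_norm_sum_cis_quadratic_le[OF nz3 \<rho>(1)])
      then show ?thesis by eventually_elim simp
    qed simp
  qed simp
  moreover have "\<forall>\<^sub>F n in sequentially. 2 * real H \<le> \<eta> / 2 * real n"
    using assms(2) by (intro eventually_le_mult_real) simp
  ultimately show ?thesis
  proof eventually_elim
    case (elim n)
    show ?case
    proof (intro allI)
      fix \<gamma> \<delta> \<kappa>
      define f where "f = (\<lambda>i. cis (\<theta> * real i ^ 3 + \<gamma> * real i ^ 2 + \<delta> * real i + \<kappa>))"
      have "norm (\<Sum>i<n. f i) \<le> sqrt (2 * \<rho>) * real n + 2 * real H"
      proof (rule norm_sum_le_of_few_correlated_shifts)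
        have corr: "f (i + h) * cnj (f (i + h')) = cis (3 * \<theta> * (real h - real h') * real i ^ 2
            + (3 * \<theta> * (real h ^ 2 - real h' ^ 2) + 2 * \<gamma> * (real h - real h')) * real i
            + (\<theta> * (real h ^ 3 - real h' ^ 3) + \<gamma> * (real h ^ 2 - real h' ^ 2) + \<delta> * (real h - real h')))"
          for i h h'
          by (simp add: f_def cis_cnj cis_mult)
            (simp add: algebra_simps power2_eq_square power3_eq_cube)
        show "real (card {(h, h'). h < H \<and> h' < H \<and>
            \<rho> * real n < norm (\<Sum>i<n. f (i + h) * cnj (f (i + h')))}) \<le> \<rho> * (real H)\<^sup>2"
        proof (rule few_diagonal)
          fix h h'
          assume *: "(h, h') \<in> {(h, h'). h < H \<and> h' < H \<and>
            \<rho> * real n < norm (\<Sum>i<n. f (i + h) * cnj (f (i + h')))}"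
          have "norm (\<Sum>i<n. f (i + h) * cnj (f (i + h'))) \<le> \<rho> * real n" if "h \<noteq> h'"
            using elim(1)[rule_format, of "(h, h')"] that * unfolding corr by auto
          then show "h = h' \<and> h < H" using * by force
        qed (fact H)
      qed (use H \<rho> in \<open>auto simp: f_def\<close>)
      also have "\<dots> \<le> \<eta> * real n" using elim(2) unfolding \<rho>(2) by simp
      finally show "norm (\<Sum>i<n. cis (\<theta> * real i ^ 3 + \<gamma> * real i ^ 2 + \<delta> * real i + \<kappa>)) \<le> \<eta> * real n"
        by (simp add: f_def)
    qed
  qed
qed

section \<open>Near-integer multiples and the resonant quadratic sum\<close>

text \<open>
  If all the near-integer multiples \<open>d * \<beta>\<close> with \<open>d < H\<close> are within \<open>\<tau>\<close> of an integer, then they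
  single out the same fraction, so they are spaced by the smallest of them, \<open>q\<close>. Moreover their distance to
  the integers grows linearly in \<open>d\<close>, so that \<open>d \<le> q\<^sup>2 / c\<close>. The spacing is used when \<open>q\<close> is large and the
  size bound when \<open>q\<close> is small.
\<close>

lemma card_near_integer_multiples_le:
  fixes \<beta> c \<tau> :: real
  assumes "c > 0" "\<tau> > 0" "2 * real H * \<tau> \<le> 1" "Q > 0"
    and far: "\<And>q p. q > 0 \<Longrightarrow> c * \<tau> / real q \<le> \<bar>real q * \<beta> - of_int p\<bar>"
  shows "real (card {d. 0 < d \<and> d < H \<and> \<bar>real d * \<beta> - of_int (round (real d * \<beta>))\<bar> < \<tau>})
    \<le> real H / real Q + real Q ^ 2 / c"
proof -
  define b where "b = (\<lambda>d::nat. round (real d * \<beta>))"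
  define B where "B = {d. 0 < d \<and> d < H \<and> \<bar>real d * \<beta> - of_int (b d)\<bar> < \<tau>}"
  have fin: "finite B" by (rule finite_subset[of _ "{..<H}"]) (auto simp: B_def)
  consider "B = {}" | "B \<noteq> {}" by blast
  then have "real (card B) \<le> real H / real Q + real Q ^ 2 / c"
  proof cases
    case 1
    then show ?thesis using assms by simp
  next
    case 2
    define q where "q = Min B"
    have qB: "q \<in> B" using 2 fin by (simp add: q_def)
    then have q: "0 < q" "q < H" "\<bar>real q * \<beta> - of_int (b q)\<bar> < \<tau>" by (auto simp: B_def)
    define \<mu> where "\<mu> = real q * \<beta> - of_int (b q)"
    have \<mu>: "c * \<tau> / real q \<le> \<bar>\<mu>\<bar>" unfolding \<mu>_def by (rule far) (fact q)
    \<comment> \<open>The difference of the two sides is an integer, and it combines the two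
      approximation errors with weights \<open>q\<close> and \<open>d\<close> below
      \<open>H\<close>. So it is smaller than \<open>2 * H * \<tau> \<le> 1\<close> and
      vanishes.\<close>
    have ratio: "int d * b q = b d * int q" if "d \<in> B" for d
    proof -
      have d: "0 < d" "d < H" "\<bar>real d * \<beta> - of_int (b d)\<bar> < \<tau>" using that by (auto simp: B_def)
      have "real_of_int (int d * b q - b d * int q)
          = real q * (real d * \<beta> - of_int (b d)) - real d * (real q * \<beta> - of_int (b q))"
        by (simp add: algebra_simps)
      then have "\<bar>real_of_int (int d * b q - b d * int q)\<bar>
          \<le> \<bar>real q * (real d * \<beta> - of_int (b d))\<bar> + \<bar>real d * (real q * \<beta> - of_int (b q))\<bar>"
        by (simp only: abs_triangle_ineq4)
      also have "\<dots> = real q * \<bar>real d * \<beta> - of_int (b d)\<bar> + real d * \<bar>real q * \<beta> - of_int (b q)\<bar>"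
        by (simp add: abs_mult)
      also have "\<dots> < real H * \<tau> + real H * \<tau>"
        using d q by (intro add_strict_mono mult_strict_mono) auto
      also have "\<dots> \<le> 1" using assms(3) by (simp add: mult.commute mult.left_commute)
      finally have "\<bar>int d * b q - b d * int q\<bar> < 1" by linarith
      then show ?thesis by simp
    qed
    have diff: "real d * \<beta> - of_int (b d) = real d / real q * \<mu>" if "d \<in> B" for d
    proof -
      have "real d * of_int (b q) = of_int (b d) * real q"
        using arg_cong[OF ratio[OF that], of real_of_int] by simp
      then show ?thesis using q by (simp add: \<mu>_def field_simps)
    qed
    \<comment> \<open>The error at \<open>d\<close> is \<open>d / q\<close> times
      \<open>\<mu>\<close>; the lower bound on \<open>\<mu>\<close> and the upper bound
      \<open>\<tau>\<close> on this error confine \<open>d\<close>.\<close>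
    have small: "real d \<le> real q ^ 2 / c" if "d \<in> B" for d
    proof -
      have "real d / real q * (c * \<tau> / real q) \<le> real d / real q * \<bar>\<mu>\<bar>"
        using \<mu> by (intro mult_left_mono) auto
      also have "\<dots> = \<bar>real d * \<beta> - of_int (b d)\<bar>" using diff[OF that] by (simp add: abs_mult)
      also have "\<dots> < \<tau>" using that by (simp add: B_def)
      finally have "real d * c * \<tau> < real q ^ 2 * \<tau>" using q by (simp add: field_simps power2_eq_square)
      then have "real d * c < real q ^ 2" using assms by simp
      then show ?thesis using assms by (simp add: field_simps)
    qed
    \<comment> \<open>By the linearity of the errors, a difference of two elements has a smaller
      error than the larger element. It therefore lies in \<open>B\<close> again and is at least the
      minimum \<open>q\<close>.\<close>
    have spaced: "q \<le> d' - d" if "d \<in> B" "d' \<in> B" "d < d'" for d d'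
    proof -
      have e: "real (d' - d) * \<beta> - of_int (b d' - b d) = real (d' - d) / real q * \<mu>"
        using diff[OF that(1)] diff[OF that(2)] that(3) by (simp add: of_nat_diff algebra_simps diff_divide_distrib)
      have "\<bar>real (d' - d) * \<beta> - of_int (b (d' - d))\<bar> \<le> \<bar>real (d' - d) * \<beta> - of_int (b d' - b d)\<bar>"
        unfolding b_def by (rule round_diff_minimal)
      also have "\<dots> \<le> \<bar>real d' / real q * \<mu>\<bar>"
        unfolding e abs_mult by (intro mult_right_mono) (auto simp: divide_right_mono)
      also have "\<dots> < \<tau>" using that(2) diff[OF that(2)] by (simp add: B_def)
      finally have "d' - d \<in> B" using that by (auto simp: B_def)
      then show ?thesis using fin by (simp add: q_def)
    qed
    show ?thesis
    proof (cases "q < Q")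
      case True
      have "B \<subseteq> {1..nat \<lfloor>real Q ^ 2 / c\<rfloor>}"
      proof
        fix d assume d: "d \<in> B"
        have "real d \<le> real q ^ 2 / c" by (rule small[OF d])
        also have "\<dots> \<le> real Q ^ 2 / c" using True assms by (intro divide_right_mono power_mono) auto
        finally show "d \<in> {1..nat \<lfloor>real Q ^ 2 / c\<rfloor>}" using d by (auto simp: B_def le_nat_floor)
      qed
      then have "card B \<le> nat \<lfloor>real Q ^ 2 / c\<rfloor>" using card_mono[of "{1..nat \<lfloor>real Q ^ 2 / c\<rfloor>}" B] by simp
      then have "real (card B) \<le> real Q ^ 2 / c"
        using assms(1) by (metis (no_types, lifting) divide_nonneg_pos le_nat_floor of_nat_floor of_nat_le_iff order_trans zero_le_power2)
      then show ?thesis using assms by (simp add: add_increasing)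
    next
      case False
      \<comment> \<open>Elements at least \<open>q\<close> apart fall into different blocks of
        length \<open>q\<close>; the block numbered 0 is empty because \<open>q\<close> is the
        minimum of \<open>B\<close>.\<close>
      have "inj_on (\<lambda>d. d div q) B"
      proof (rule inj_onI, rule ccontr)
        fix d d' assume *: "d \<in> B" "d' \<in> B" "d div q = d' div q" "d \<noteq> d'"
        have no: False if "u \<in> B" "w \<in> B" "u div q = w div q" "u < w" for u w
        proof -
          have "u + q \<le> w" using spaced[OF that(1,2,4)] that(4) by simp
          then have "(u + q) div q \<le> w div q" by (rule div_le_mono)
          then show False using that(3) q by simp
        qed
        show False using * no[of d d'] no[of d' d] by (cases "d < d'") auto
      qed
      moreover have "(\<lambda>d. d div q) ` B \<subseteq> {1..H div q}"
      proof
        fix e assume "e \<in> (\<lambda>d. d div q) ` B"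
        then obtain d where d: "d \<in> B" "e = d div q" by blast
        have "q \<le> d" using d fin by (simp add: q_def)
        then have "q div q \<le> d div q" by (rule div_le_mono)
        moreover have "d div q \<le> H div q" using d by (intro div_le_mono) (simp add: B_def)
        ultimately show "e \<in> {1..H div q}" using d q by simp
      qed
      ultimately have "card B \<le> H div q"
        using card_inj_on_le[of "\<lambda>d. d div q" B "{1..H div q}"] by simp
      then have "real (card B) \<le> real H / real q"
        using of_nat_div_le_of_nat[of H q, where ?'a = real] by linarith
      also have "\<dots> \<le> real H / real Q" using False assms by (intro divide_left_mono) auto
      finally show ?thesis using assms by (simp add: add_increasing2)
    qed
  qed
  then show ?thesis by (simp add: B_def b_def)
qed

text \<open>The sine threshold \<open>\<tau> = 1 / (\<rho> * n)\<close> and the bad approximability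
  bound for multiples of \<open>sqrt 2 * g * n\<close> both scale like \<open>1 / n\<close>. Their
  ratio \<open>c\<close> is thus free of \<open>n\<close>, and the count of resonant shifts is
  bounded by a small multiple of \<open>H\<close> with \<open>H\<close> chosen before
  \<open>n\<close>.\<close>

lemma eventually_norm_sum_cis_resonant_le:
  fixes g :: nat and \<eta> :: real
  assumes "g > 0" "\<eta> > 0"
  shows "\<forall>\<^sub>F n in sequentially. \<forall>\<gamma> \<delta> \<kappa>. \<bar>\<gamma>\<bar> = pi * (sqrt 2 * real (g * n)) \<longrightarrow>
    norm (\<Sum>i<n. cis (\<gamma> * real i ^ 2 + \<delta> * real i + \<kappa>)) \<le> \<eta> * real n"
proof -
  define \<rho> where "\<rho> = \<eta>\<^sup>2 / 8"
  have \<rho>: "\<rho> > 0" "sqrt (2 * \<rho>) = \<eta> / 2"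
    using assms(2) sqrt_double_eighth_square by (auto simp: \<rho>_def)
  define c where "c = \<rho> / (4 * real g)"
  have c: "c > 0" using \<rho> assms by (simp add: c_def)
  \<comment> \<open>\<open>Q\<close> makes \<open>H / Q\<close> at most an eighth of
    \<open>\<rho> * H\<close>; then \<open>H\<close> does the same for \<open>Q ^ 2 / c\<close> and
    makes 1 at most half of it. Together this yields
    \<open>1 + 2 * card B \<le> \<rho> * H\<close>.\<close>
  obtain Q :: nat where Q: "Q > 0" "8 \<le> \<rho> * real Q"
    using ex_nat_ge_mult[OF \<rho>(1)] .
  obtain H :: nat where H: "H > 0" "max (8 * (real Q ^ 2 / c)) 2 \<le> \<rho> * real H"
    using ex_nat_ge_mult[OF \<rho>(1)] .
  have "real H * 8 \<le> real H * (\<rho> * real Q)" using Q by (intro mult_left_mono) auto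
  then have HQ: "8 * (real H / real Q) \<le> \<rho> * real H" using Q by (simp add: field_simps)
  have "\<forall>\<^sub>F n in sequentially. 2 * real H \<le> \<rho> * real n"
    using \<rho> by (intro eventually_le_mult_real) simp
  moreover have "\<forall>\<^sub>F n in sequentially. 2 * real H \<le> \<eta> / 2 * real n"
    using assms(2) by (intro eventually_le_mult_real) simp
  ultimately show ?thesis using eventually_gt_at_top[of 0]
  proof eventually_elim
    case (elim n)
    define \<beta> where "\<beta> = sqrt 2 * real (g * n)"
    define \<tau> where "\<tau> = 1 / (\<rho> * real n)"
    define B where "B = {d. 0 < d \<and> d < H \<and> \<bar>real d * \<beta> - of_int (round (real d * \<beta>))\<bar> < \<tau>}"
    have finB: "finite B" by (rule finite_subset[of _ "{..<H}"]) (auto simp: B_def)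
    have "real (card B) \<le> real H / real Q + real Q ^ 2 / c"
      unfolding B_def
    proof (rule card_near_integer_multiples_le)
      show "2 * real H * \<tau> \<le> 1" using elim \<rho> by (simp add: \<tau>_def)
      fix q :: nat and p :: int
      assume q: "q > 0"
      have "c * \<tau> / real q = 1 / (4 * real (q * (g * n)))" using \<rho> by (simp add: c_def \<tau>_def)
      also have "\<dots> \<le> \<bar>sqrt 2 * real (q * (g * n)) - of_int p\<bar>"
        using q assms elim by (intro sqrt2_badly_approximable) simp
      also have "\<dots> = \<bar>real q * \<beta> - of_int p\<bar>" by (simp add: \<beta>_def mult.left_commute)
      finally show "c * \<tau> / real q \<le> \<bar>real q * \<beta> - of_int p\<bar>" .
    qed (use c \<rho> elim Q in \<open>auto simp: \<tau>_def\<close>)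
    then have cardB: "1 + 2 * real (card B) \<le> \<rho> * real H" using HQ H(2) by linarith
    show ?case
    proof (intro allI impI)
      fix \<gamma> \<delta> \<kappa> :: real
      assume \<gamma>: "\<bar>\<gamma>\<bar> = pi * (sqrt 2 * real (g * n))"
      define P where "P = {(h, h'). h < H \<and> h' < H \<and> \<bar>sin (\<gamma> * (real h - real h'))\<bar> * (\<rho> * real n) < 1}"
      \<comment> \<open>The candidates for a resonant partner of \<open>h\<close>: \<open>h\<close>
        itself and \<open>h\<close> shifted up or down by an element of \<open>B\<close>. Truncated
        subtraction can only add a spurious candidate 0, which is harmless for an upper
        bound.\<close>
      define N where "N = (\<lambda>h. insert h ((\<lambda>d. h + d) ` B \<union> (\<lambda>d. h - d) ` B))"
      have "P \<subseteq> Sigma {..<H} N"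
      proof
        fix z assume "z \<in> P"
        then obtain h h' where z: "z = (h, h')" "h < H" "h' < H"
          and s: "\<bar>sin (\<gamma> * (real h - real h'))\<bar> * (\<rho> * real n) < 1"
          by (auto simp: P_def)
        define d where "d = (if h < h' then h' - h else h - h')"
        have "\<bar>sin (\<gamma> * (real h - real h'))\<bar> = \<bar>sin \<bar>\<gamma> * (real h - real h')\<bar>\<bar>" by (simp add: abs_if)
        also have "\<bar>\<gamma> * (real h - real h')\<bar> = pi * (real d * \<beta>)"
          by (simp only: abs_mult \<gamma>) (simp add: d_def \<beta>_def of_nat_diff)
        finally have "\<bar>sin (pi * (real d * \<beta>))\<bar> < \<tau>"
          using s \<rho> elim by (simp add: \<tau>_def field_simps)
        then have small: "\<bar>real d * \<beta> - of_int (round (real d * \<beta>))\<bar> < \<tau>"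
          using abs_sin_pi_ge_dist_int[of "real d * \<beta>"] by linarith
        show "z \<in> Sigma {..<H} N"
        proof (cases "d = 0")
          case True
          then show ?thesis using z by (auto simp: N_def d_def split: if_splits)
        next
          case False
          then have dB: "d \<in> B" using small z by (auto simp: B_def d_def)
          have "h' = h + d \<or> h' = h - d" by (auto simp: d_def)
          then show ?thesis using dB z by (auto simp: N_def)
        qed
      qed
      then have "card P \<le> card (Sigma {..<H} N)" using finB by (intro card_mono) (auto simp: N_def)
      also have "\<dots> = (\<Sum>h<H. card (N h))" using finB by (intro card_SigmaI) (auto simp: N_def)
      also have "\<dots> \<le> (\<Sum>h<H. 1 + 2 * card B)"
      proof (rule sum_mono)
        fix h
        have "card (N h) \<le> Suc (card ((\<lambda>d. h + d) ` B \<union> (\<lambda>d. h - d) ` B))"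
          unfolding N_def by (rule card_insert_le_m1[THEN order_trans]) (auto intro: card_insert_le_m1)
        also have "\<dots> \<le> Suc (card ((\<lambda>d. h + d) ` B) + card ((\<lambda>d. h - d) ` B))"
          using card_Un_le by simp
        also have "\<dots> \<le> Suc (card B + card B)"
          using finB by (intro Suc_leI le_imp_less_Suc add_mono card_image_le)
        finally show "card (N h) \<le> 1 + 2 * card B" by simp
      qed
      finally have "card P \<le> H * (1 + 2 * card B)" by simp
      then have "real (card P) \<le> real H * (1 + 2 * real (card B))"
        by (metis (mono_tags, lifting) of_nat_1 of_nat_add of_nat_le_iff of_nat_mult of_nat_numeral)
      also have "\<dots> \<le> real H * (\<rho> * real H)" using cardB by (intro mult_left_mono) auto
      finally have "real (card P) \<le> \<rho> * (real H)\<^sup>2" by (simp add: power2_eq_square algebra_simps)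
      then have "norm (\<Sum>i<n. cis (\<gamma> * real i ^ 2 + \<delta> * real i + \<kappa>)) \<le> sqrt (2 * \<rho>) * real n + 2 * real H"
        using H \<rho> unfolding P_def by (intro norm_sum_cis_quadratic_le) auto
      also have "\<dots> \<le> \<eta> * real n" using elim(2) unfolding \<rho>(2) by simp
      finally show "norm (\<Sum>i<n. cis (\<gamma> * real i ^ 2 + \<delta> * real i + \<kappa>)) \<le> \<eta> * real n" .
    qed
  qed
qed

section \<open>Exponential sums along the cubic phase\<close>

definition phase :: "nat \<Rightarrow> real" where
  "phase k = pi * (2 * sqrt 2 * real k ^ 3)"

lemma sin_pi_sqrt2_nonzero:
  fixes m :: int
  assumes "m \<noteq> 0"
  shows "sin (pi * (sqrt 2 * of_int m)) \<noteq> 0"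
proof
  assume "sin (pi * (sqrt 2 * of_int m)) = 0"
  then obtain p where "pi * (sqrt 2 * of_int m) = of_int p * pi" using sin_zero_iff_int2 by blast
  then have p: "sqrt 2 * of_int m = of_int p" by simp
  define q where "q = nat \<bar>m\<bar>"
  have q: "q > 0" "real q = (if m < 0 then - of_int m else of_int m)" using assms by (auto simp: q_def)
  then have "sqrt 2 * real q = of_int (if m < 0 then - p else p)" using p by auto
  then show False using sqrt2_badly_approximable[of q "if m < 0 then - p else p"] q(1) by simp
qed

text \<open>Expanding in powers of \<open>i\<close>, the starting point \<open>k\<close> enters only
  the coefficients below the leading one, in both cases. The bounds for cubic and resonant quadratic
  sums are uniform in those, which gives uniformity in \<open>k\<close>.\<close>

lemma eventually_norm_sum_cis_phase_le:
  fixes a b :: int and \<eta> :: real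
  assumes "a \<noteq> 0 \<or> b \<noteq> 0" and \<eta>: "\<eta> > 0"
  shows "\<forall>\<^sub>F n in sequentially. \<forall>k.
    norm (\<Sum>i<n. cis (of_int a * phase (k + i) + of_int b * phase (k + n + i))) \<le> \<eta> * real n"
proof (cases "a + b = 0")
  case False
  define w where "w = pi * (2 * sqrt 2)"
  define \<theta> where "\<theta> = w * (of_int a + of_int b)"
  have "\<forall>\<^sub>F n in sequentially. \<forall>\<gamma> \<delta> \<kappa>.
    norm (\<Sum>i<n. cis (\<theta> * real i ^ 3 + \<gamma> * real i ^ 2 + \<delta> * real i + \<kappa>)) \<le> \<eta> * real n"
  proof (rule eventually_norm_sum_cis_cubic_le[OF _ \<eta>])
    fix d :: nat assume "d > 0"
    then have "sin (pi * (sqrt 2 * of_int (2 * (a + b) * int d))) \<noteq> 0"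
      using False by (intro sin_pi_sqrt2_nonzero) auto
    then show "sin (\<theta> * real d) \<noteq> 0" by (simp add: \<theta>_def w_def algebra_simps)
  qed
  then show ?thesis
  proof eventually_elim
    case (elim n)
    show ?case
    proof
      fix k
      define x y where "x = real k" and "y = real k + real n"
      have "of_int a * phase (k + i) + of_int b * phase (k + n + i)
          = \<theta> * real i ^ 3 + (w * (3 * (of_int a * x + of_int b * y))) * real i ^ 2
            + (w * (3 * (of_int a * x ^ 2 + of_int b * y ^ 2))) * real i + w * (of_int a * x ^ 3 + of_int b * y ^ 3)" for i
      proof -
        have "phase (k + i) = w * (x + real i) ^ 3" "phase (k + n + i) = w * (y + real i) ^ 3"
          by (simp_all add: phase_def w_def x_def y_def)
        then show ?thesis by (simp add: \<theta>_def power3_eq_cube power2_eq_square algebra_simps)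
      qed
      then show "norm (\<Sum>i<n. cis (of_int a * phase (k + i) + of_int b * phase (k + n + i))) \<le> \<eta> * real n"
        using elim by simp
    qed
  qed
next
  case True
  then have b: "b = - a" and a: "a \<noteq> 0" using assms by auto
  define w where "w = pi * (2 * sqrt 2)"
  \<comment> \<open>The quadratic coefficient is \<open>2 * sqrt 2 * pi\<close> times
    \<open>- 3 * a * n\<close>, so its size is \<open>pi * sqrt 2\<close> times
    \<open>6 * \<bar>a\<bar> * n\<close>.\<close>
  define g where "g = nat \<bar>6 * a\<bar>"
  have "g > 0" using a by (simp add: g_def)
  from eventually_norm_sum_cis_resonant_le[OF this \<eta>] show ?thesis
  proof eventually_elim
    case (elim n)
    show ?case
    proof
      fix k
      define x y where "x = real k" and "y = real n"
      define \<gamma> where "\<gamma> = w * (- 3 * of_int a * y)"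
      have eq: "of_int a * phase (k + i) + of_int b * phase (k + n + i)
          = \<gamma> * real i ^ 2 + (w * (- 3 * of_int a * (2 * x * y + y ^ 2))) * real i
            + w * (- of_int a * (3 * x ^ 2 * y + 3 * x * y ^ 2 + y ^ 3))" for i
      proof -
        have "phase (k + i) = w * (x + real i) ^ 3" "phase (k + n + i) = w * (x + y + real i) ^ 3"
          by (simp_all add: phase_def w_def x_def y_def)
        then show ?thesis by (simp add: \<gamma>_def b power3_eq_cube power2_eq_square algebra_simps)
      qed
      have \<gamma>: "\<bar>\<gamma>\<bar> = pi * (sqrt 2 * real (g * n))"
        by (simp add: \<gamma>_def w_def y_def g_def abs_mult)
      show "norm (\<Sum>i<n. cis (of_int a * phase (k + i) + of_int b * phase (k + n + i))) \<le> \<eta> * real n"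
        unfolding eq by (rule elim[rule_format, OF \<gamma>])
    qed
  qed
qed

section \<open>Trigonometric polynomials of the phase\<close>

text \<open>The window length \<open>n\<close> is an argument of \<open>F\<close> because the second
  interval is displaced by \<open>n\<close>; the decay is uniform in the starting point
  \<open>k\<close>.\<close>

definition has_null_averages :: "(nat \<Rightarrow> nat \<Rightarrow> nat \<Rightarrow> complex) \<Rightarrow> bool" where
  "has_null_averages F \<longleftrightarrow>
    (\<forall>\<eta>>0. \<forall>\<^sub>F n in sequentially. \<forall>k. norm (\<Sum>i<n. F n k i) \<le> \<eta> * real n)"

lemma has_null_averages_zero: "has_null_averages (\<lambda>n k i. 0)"
  by (simp add: has_null_averages_def)

lemma has_null_averages_add:
  assumes "has_null_averages F" "has_null_averages G"
  shows "has_null_averages (\<lambda>n k i. F n k i + G n k i)"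
  unfolding has_null_averages_def
proof (intro allI impI)
  fix \<eta> :: real assume "\<eta> > 0"
  then have "\<eta> / 2 > 0" by simp
  from assms(1)[unfolded has_null_averages_def, rule_format, OF this]
    assms(2)[unfolded has_null_averages_def, rule_format, OF this]
  show "\<forall>\<^sub>F n in sequentially. \<forall>k. norm (\<Sum>i<n. F n k i + G n k i) \<le> \<eta> * real n"
  proof eventually_elim
    case (elim n)
    show ?case
    proof
      fix k
      have "norm (\<Sum>i<n. F n k i + G n k i) \<le> norm (\<Sum>i<n. F n k i) + norm (\<Sum>i<n. G n k i)"
        unfolding sum.distrib by (rule norm_triangle_ineq)
      also have "\<dots> \<le> \<eta> / 2 * real n + \<eta> / 2 * real n"
        by (intro add_mono elim[rule_format])
      finally show "norm (\<Sum>i<n. F n k i + G n k i) \<le> \<eta> * real n" by simp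
    qed
  qed
qed

lemma has_null_averages_cmult:
  assumes "has_null_averages F"
  shows "has_null_averages (\<lambda>n k i. c * F n k i)"
  unfolding has_null_averages_def
proof (intro allI impI)
  fix \<eta> :: real assume \<eta>: "\<eta> > 0"
  then have "\<eta> / (norm c + 1) > 0" by (simp add: add_nonneg_pos)
  from assms[unfolded has_null_averages_def, rule_format, OF this]
  show "\<forall>\<^sub>F n in sequentially. \<forall>k. norm (\<Sum>i<n. c * F n k i) \<le> \<eta> * real n"
  proof eventually_elim
    case (elim n)
    show ?case
    proof
      fix k
      have "norm (\<Sum>i<n. c * F n k i) = norm c * norm (\<Sum>i<n. F n k i)"
        by (simp add: sum_distrib_left[symmetric] norm_mult)
      also have "\<dots> \<le> (norm c + 1) * (\<eta> / (norm c + 1) * real n)"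
        by (intro mult_mono elim[rule_format]) auto
      also have "\<dots> = \<eta> * real n"
        using add_nonneg_pos[of "norm c" 1] by simp
      finally show "norm (\<Sum>i<n. c * F n k i) \<le> \<eta> * real n" .
    qed
  qed
qed

lemma has_null_averages_sum:
  assumes "\<And>a. a \<in> A \<Longrightarrow> has_null_averages (F a)"
  shows "has_null_averages (\<lambda>n k i. \<Sum>a\<in>A. F a n k i)"
  using assms
  by (induction A rule: infinite_finite_induct) (auto intro: has_null_averages_zero has_null_averages_add)

text \<open>Oddness of the frequencies excludes the frequency 0, so no constant term can spoil the
  cancellation.\<close>

inductive odd_trig_poly :: "(real \<Rightarrow> complex) \<Rightarrow> bool" where
  zero: "odd_trig_poly (\<lambda>x. 0)"
| add_cis: "odd_trig_poly f \<Longrightarrow> odd l \<Longrightarrow> odd_trig_poly (\<lambda>x. f x + c * cis (of_int l * x))"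

lemma odd_trig_poly_add:
  assumes "odd_trig_poly f" "odd_trig_poly g"
  shows "odd_trig_poly (\<lambda>x. f x + g x)"
  using assms(2)
proof induction
  case zero
  then show ?case using assms(1) by simp
next
  case (add_cis g l c)
  then show ?case using odd_trig_poly.add_cis[of "\<lambda>x. f x + g x" l c] by (simp add: add.assoc)
qed

lemma odd_trig_poly_cmult:
  assumes "odd_trig_poly f"
  shows "odd_trig_poly (\<lambda>x. c * f x)"
  using assms
proof induction
  case (add_cis f l c')
  then show ?case using odd_trig_poly.add_cis[of "\<lambda>x. c * f x" l "c * c'"] by (simp add: algebra_simps)
qed (simp add: odd_trig_poly.zero)

lemma odd_trig_poly_mult_cis:
  assumes "odd_trig_poly f" "even l"
  shows "odd_trig_poly (\<lambda>x. f x * cis (of_int l * x))"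
  using assms(1)
proof induction
  case (add_cis f l' c)
  have "(f x + c * cis (of_int l' * x)) * cis (of_int l * x)
      = f x * cis (of_int l * x) + c * cis (of_int (l' + l) * x)" for x
    by (simp add: algebra_simps cis_mult)
  then show ?case
    using odd_trig_poly.add_cis[of "\<lambda>x. f x * cis (of_int l * x)" "l' + l" c] add_cis assms(2) by simp
qed (simp add: odd_trig_poly.zero)

lemma odd_trig_poly_sum:
  assumes "\<And>a. a \<in> A \<Longrightarrow> odd_trig_poly (f a)"
  shows "odd_trig_poly (\<lambda>x. \<Sum>a\<in>A. f a x)"
  using assms
  by (induction A rule: infinite_finite_induct) (auto intro: odd_trig_poly.zero odd_trig_poly_add)

lemma of_real_sin_eq_cis: "complex_of_real (sin x) = (cis x - cis (- x)) / (2 * \<i>)"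
  by (simp add: complex_eq_iff)

lemma of_real_cos_eq_cis: "complex_of_real (cos x) = (cis x + cis (- x)) / 2"
  by (simp add: complex_eq_iff)

text \<open>Multiplying by the squared cosine moves frequencies by 2, 0 or -2, which preserves their
  parity.\<close>

lemma odd_trig_poly_sin_times_cos_power:
  "odd_trig_poly (\<lambda>x. complex_of_real (sin x * (cos x ^ 2) ^ j))"
proof (induction j)
  case 0
  have eq: "complex_of_real (sin x * (cos x ^ 2) ^ 0)
      = 0 + 1 / (2 * \<i>) * cis (of_int 1 * x) + (- 1 / (2 * \<i>)) * cis (of_int (- 1) * x)" for x
    unfolding power_0 mult_1_right of_real_sin_eq_cis by (simp add: field_simps)
  show ?case unfolding eq by (intro odd_trig_poly.intros) auto
next
  case (Suc j)
  define f where "f = (\<lambda>x. complex_of_real (sin x * (cos x ^ 2) ^ j))"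
  have "odd_trig_poly (\<lambda>x. 1 / 4 * (f x * cis (of_int 2 * x)) + 1 / 4 * (f x * cis (of_int (- 2) * x)) + 1 / 2 * f x)"
    by (intro odd_trig_poly_add odd_trig_poly_cmult odd_trig_poly_mult_cis) (use Suc f_def in auto)
  moreover have "complex_of_real (sin x * (cos x ^ 2) ^ Suc j)
      = 1 / 4 * (f x * cis (of_int 2 * x)) + 1 / 4 * (f x * cis (of_int (- 2) * x)) + 1 / 2 * f x" for x
  proof -
    have "complex_of_real (sin x * (cos x ^ 2) ^ Suc j) = f x * complex_of_real (cos x) ^ 2"
      by (simp add: f_def)
    also have "\<dots> = f x * ((cis x * cis x + 2 * (cis x * cis (- x)) + cis (- x) * cis (- x)) / 4)"
      unfolding of_real_cos_eq_cis by (simp add: power2_eq_square field_simps del: cis_inverse)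
    also have "\<dots> = f x * ((cis (of_int 2 * x) + 2 + cis (of_int (- 2) * x)) / 4)"
      by (simp add: cis_mult del: cis_inverse)
    finally show ?thesis by (simp add: field_simps)
  qed
  ultimately show ?case by simp
qed

text \<open>By bilinearity it suffices to treat a pair of pure frequencies, and an odd
  \<open>l\<close> makes the pair nonzero.\<close>

lemma has_null_averages_odd_trig_poly_product:
  assumes "odd_trig_poly f" "odd_trig_poly g"
  shows "has_null_averages (\<lambda>n k i. f (phase (k + i)) * g (phase (k + n + i)))"
  using assms(1)
proof induction
  case (add_cis f l c)
  have "has_null_averages (\<lambda>n k i. cis (of_int l * phase (k + i)) * g (phase (k + n + i)))"
    using assms(2)
  proof induction
    case (add_cis g l' c')
    have "l \<noteq> 0" using \<open>odd l\<close> by auto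
    then have "has_null_averages (\<lambda>n k i. cis (of_int l * phase (k + i) + of_int l' * phase (k + n + i)))"
      unfolding has_null_averages_def by (intro allI impI eventually_norm_sum_cis_phase_le) auto
    from has_null_averages_add[OF add_cis.IH has_null_averages_cmult[OF this, of c']]
    show ?case by (simp add: cis_mult[symmetric] algebra_simps)
  qed (simp add: has_null_averages_zero)
  from has_null_averages_add[OF add_cis.IH has_null_averages_cmult[OF this, of c]]
  show ?case by (simp add: algebra_simps)
qed (simp add: has_null_averages_zero)

section \<open>Means of even powers of the cosine\<close>

lemma of_real_cos_power_eq:
  "complex_of_real (cos x ^ p) = (\<Sum>j\<le>p. of_nat (p choose j) / 2 ^ p * cis (of_int (2 * int j - int p) * x))"
proof -
  have "complex_of_real (cos x ^ p) = (cis x + cis (- x)) ^ p / 2 ^ p"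
    by (simp add: of_real_cos_eq_cis power_divide del: cis_inverse)
  also have "\<dots> = (\<Sum>j\<le>p. of_nat (p choose j) * cis x ^ j * cis (- x) ^ (p - j)) / 2 ^ p"
    by (simp add: binomial_ring)
  also have "\<dots> = (\<Sum>j\<le>p. of_nat (p choose j) / 2 ^ p * cis (of_int (2 * int j - int p) * x))"
    unfolding sum_divide_distrib
  proof (rule sum.cong[OF refl])
    fix j assume "j \<in> {..p}"
    then have "cis x ^ j * cis (- x) ^ (p - j) = cis (of_int (2 * int j - int p) * x)"
      by (simp add: Complex.DeMoivre cis_mult of_nat_diff algebra_simps)
    then show "of_nat (p choose j) * cis x ^ j * cis (- x) ^ (p - j) / 2 ^ p
        = of_nat (p choose j) / 2 ^ p * cis (of_int (2 * int j - int p) * x)"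
      by (simp add: mult.assoc)
  qed
  finally show ?thesis .
qed

text \<open>The term \<open>j = m\<close> of the binomial expansion is the constant one and equals
  the mean; all others have a nonzero frequency at \<open>k + i\<close>, paired with the frequency 0
  at the second point.\<close>

lemma has_null_averages_cos_power_minus_mean:
  "has_null_averages (\<lambda>n k i. complex_of_real ((cos (phase (k + i)) ^ 2) ^ m - real (2 * m choose m) / 4 ^ m))"
proof -
  have "has_null_averages (\<lambda>n k i. \<Sum>j\<in>{..2 * m} - {m}.
      of_nat (2 * m choose j) / 2 ^ (2 * m) * cis (of_int (2 * int j - int (2 * m)) * phase (k + i)))"
  proof (intro has_null_averages_sum has_null_averages_cmult)
    fix j assume "j \<in> {..2 * m} - {m}"
    then have "2 * int j - int (2 * m) \<noteq> 0" by auto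
    then show "has_null_averages (\<lambda>n k i. cis (of_int (2 * int j - int (2 * m)) * phase (k + i)))"
      unfolding has_null_averages_def
      using eventually_norm_sum_cis_phase_le[of "2 * int j - int (2 * m)" 0] by simp
  qed
  moreover have "(\<Sum>j\<in>{..2 * m} - {m}. of_nat (2 * m choose j) / 2 ^ (2 * m) * cis (of_int (2 * int j - int (2 * m)) * x))
      = complex_of_real ((cos x ^ 2) ^ m - real (2 * m choose m) / 4 ^ m)" for x
  proof -
    have "complex_of_real ((cos x ^ 2) ^ m)
        = (\<Sum>j\<le>2 * m. of_nat (2 * m choose j) / 2 ^ (2 * m) * cis (of_int (2 * int j - int (2 * m)) * x))"
      unfolding power_mult[symmetric] by (rule of_real_cos_power_eq)
    also have "\<dots> = of_nat (2 * m choose m) / 2 ^ (2 * m) * cis (of_int (2 * int m - int (2 * m)) * x)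
        + (\<Sum>j\<in>{..2 * m} - {m}. of_nat (2 * m choose j) / 2 ^ (2 * m) * cis (of_int (2 * int j - int (2 * m)) * x))"
      by (rule sum.remove) auto
    finally have "complex_of_real ((cos x ^ 2) ^ m) = of_nat (2 * m choose m) / 2 ^ (2 * m)
        + (\<Sum>j\<in>{..2 * m} - {m}. of_nat (2 * m choose j) / 2 ^ (2 * m) * cis (of_int (2 * int j - int (2 * m)) * x))"
      by simp
    moreover have "(2 :: complex) ^ (2 * m) = 4 ^ m" unfolding power_mult by simp
    ultimately show ?thesis unfolding of_real_diff by simp
  qed
  ultimately show ?thesis by simp
qed

text \<open>The weight \<open>2 * m + 1\<close> lets the induction close: the quotient gains the
  factor \<open>(2 * m + 1) / (2 * m + 2)\<close>, and
  \<open>(2 * m + 1) * (2 * m + 3) \<le> (2 * m + 2) ^ 2\<close>.\<close>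

lemma central_binomial_quotient_sq_le: "(2 * real m + 1) * (real (2 * m choose m) / 4 ^ m)\<^sup>2 \<le> 1"
proof (induction m)
  case (Suc m)
  define r where "r = real (2 * m choose m) / 4 ^ m"
  have b: "real (2 * Suc m choose Suc m) * (real m + 1) = 2 * (2 * real m + 1) * real (2 * m choose m)"
  proof -
    have "real (2 * Suc m choose Suc m) = fact (2 * Suc m) / (fact (Suc m) * fact (Suc m))"
      by (subst binomial_fact) (auto simp del: fact_Suc)
    also have "fact (2 * Suc m) = (2 * real m + 2) * ((2 * real m + 1) * fact (2 * m))"
      by (simp add: algebra_simps)
    also have "fact (Suc m) = (real m + 1) * fact m" by simp
    finally have 1: "real (2 * Suc m choose Suc m)
        = (2 * real m + 2) * ((2 * real m + 1) * fact (2 * m)) / ((real m + 1) * fact m * ((real m + 1) * fact m))" .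
    have 2: "real (2 * m choose m) = fact (2 * m) / (fact m * fact m)"
      by (subst binomial_fact) auto
    have "(real m + 1) \<noteq> 0" by linarith
    then show ?thesis unfolding 1 2 by (simp add: divide_simps) (simp add: algebra_simps)
  qed
  have pos: "real m + 1 \<noteq> 0" by linarith
  have "real (2 * Suc m choose Suc m) / 4 ^ Suc m = 2 * (2 * real m + 1) * real (2 * m choose m) / (real m + 1) / 4 ^ Suc m"
    using b pos by (simp add: eq_divide_eq)
  also have "\<dots> = r * (2 * real m + 1) / (2 * (real m + 1))"
  proof -
    have "2 * a * x / s / (4 * p) = x / p * a / (2 * s)" if "s \<noteq> 0" "p \<noteq> 0" for a x s p :: real
      using that by (simp add: field_simps)
    from this[OF pos, of "4 ^ m" "2 * real m + 1"] show ?thesis unfolding r_def power_Suc by simp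
  qed
  finally have eq: "real (2 * Suc m choose Suc m) / 4 ^ Suc m = r * (2 * real m + 1) / (2 * (real m + 1))" .
  have "(2 * real (Suc m) + 1) * (r * (2 * real m + 1) / (2 * (real m + 1)))\<^sup>2
      = ((2 * real m + 1) * r\<^sup>2) * ((2 * real m + 1) * (2 * real m + 3) / (2 * (real m + 1))\<^sup>2)"
    by (simp add: power2_eq_square)
  also have "\<dots> \<le> 1 * 1"
  proof (rule mult_mono)
    show "(2 * real m + 1) * r\<^sup>2 \<le> 1" using Suc by (simp add: r_def)
    have "(2 * real m + 1) * (2 * real m + 3) \<le> (2 * (real m + 1))\<^sup>2"
      by (simp add: power2_eq_square algebra_simps)
    then show "(2 * real m + 1) * (2 * real m + 3) / (2 * (real m + 1))\<^sup>2 \<le> 1"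
      using pos by (simp add: divide_le_eq_1)
  qed auto
  finally show ?case unfolding eq by simp
qed simp

lemma central_binomial_quotient_small:
  fixes \<epsilon> :: real
  assumes "\<epsilon> > 0"
  obtains m where "real (2 * m choose m) / 4 ^ m \<le> \<epsilon>"
proof -
  obtain m :: nat where m: "m > 0" "1 \<le> \<epsilon>\<^sup>2 * real m"
    using ex_nat_ge_mult[of "\<epsilon>\<^sup>2" 1] assms by auto
  note central_binomial_quotient_sq_le[of m]
  also note m(2)
  also have "\<epsilon>\<^sup>2 * real m \<le> \<epsilon>\<^sup>2 * (2 * real m + 1)" by (rule mult_left_mono) auto
  finally have "(2 * real m + 1) * (real (2 * m choose m) / 4 ^ m)\<^sup>2 \<le> (2 * real m + 1) * \<epsilon>\<^sup>2"
    by (simp only: mult.commute)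
  then have "(real (2 * m choose m) / 4 ^ m)\<^sup>2 \<le> \<epsilon>\<^sup>2" by simp
  then have "real (2 * m choose m) / 4 ^ m \<le> \<epsilon>"
    by (rule power2_le_imp_le) (use assms in simp)
  then show ?thesis by (rule that)
qed

section \<open>Polynomial approximation of the sign function\<close>

text \<open>The Taylor coefficients of $(1 - t)^{-1/2}$, so that $y$ times the truncated series at
  $t = 1 - y^2$ approximates $y / |y|$.\<close>

definition rsqrt_coeff :: "nat \<Rightarrow> real" where
  "rsqrt_coeff j = pochhammer (1 / 2) j / fact j"

definition rsqrt_poly :: "nat \<Rightarrow> real \<Rightarrow> real" where
  "rsqrt_poly m t = (\<Sum>j<m. rsqrt_coeff j * t ^ j)"

lemma rsqrt_coeff_nonneg: "0 \<le> rsqrt_coeff j"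
  by (simp add: rsqrt_coeff_def pochhammer_nonneg)

text \<open>The square of the series is \<open>1 / (1 - t)\<close>, with all coefficients 1;
  formally this is Vandermonde's identity for \<open>- 1 / 2 + - 1 / 2 = - 1\<close>.\<close>

lemma rsqrt_coeff_convolution: "(\<Sum>j\<le>k. rsqrt_coeff j * rsqrt_coeff (k - j)) = 1"
proof -
  have c: "((- 1 / 2 :: real) gchoose j) = (- 1) ^ j * rsqrt_coeff j" for j
    by (simp add: gbinomial_pochhammer rsqrt_coeff_def)
  have "(- 1) ^ k = ((- 1 / 2 + - 1 / 2 :: real) gchoose k)"
    using gbinomial_minus[of "1::real" k] binomial_gbinomial[of k k, where 'a = real] by simp
  also have "\<dots> = (\<Sum>j\<le>k. ((- 1 / 2) gchoose j) * ((- 1 / 2) gchoose (k - j)))"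
    by (simp only: gbinomial_Vandermonde[symmetric] atLeast0AtMost)
  also have "\<dots> = (\<Sum>j\<le>k. (- 1) ^ k * (rsqrt_coeff j * rsqrt_coeff (k - j)))"
  proof (rule sum.cong[OF refl])
    fix j assume "j \<in> {..k}"
    then have "(- 1 :: real) ^ k = (- 1) ^ j * (- 1) ^ (k - j)" by (simp flip: power_add)
    then show "((- 1 / 2) gchoose j) * ((- 1 / 2) gchoose (k - j))
        = (- 1) ^ k * (rsqrt_coeff j * rsqrt_coeff (k - j))"
      unfolding c by simp
  qed
  finally show ?thesis by (simp add: sum_distrib_left[symmetric])
qed

text \<open>Squaring the polynomial sums nonnegative terms over the square \<open>i, j < m\<close>,
  which lies between the triangles \<open>i + j < m\<close> and \<open>i + j < 2 * m\<close>. By the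
  convolution identity the triangles give partial geometric sums.\<close>

lemma rsqrt_poly_sq_bounds:
  fixes t :: real
  assumes t: "0 \<le> t" "t \<le> 1"
  shows "1 - t ^ m \<le> (1 - t) * (rsqrt_poly m t)\<^sup>2" "(1 - t) * (rsqrt_poly m t)\<^sup>2 \<le> 1"
proof -
  define c where "c = (\<lambda>(i, j). rsqrt_coeff i * rsqrt_coeff j * t ^ (i + j))"
  have c_nonneg: "0 \<le> c z" for z
    using t by (cases z) (simp add: c_def rsqrt_coeff_nonneg)
  have tri: "sum c {(i, j). i + j < n} = (\<Sum>k<n. t ^ k)" for n
  proof -
    have "sum c {(i, j). i + j < n} = (\<Sum>k<n. \<Sum>i\<le>k. c (i, k - i))"
      using sum.triangle_reindex[of "\<lambda>i j. c (i, j)" n] by simp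
    also have "\<dots> = (\<Sum>k<n. t ^ k * (\<Sum>i\<le>k. rsqrt_coeff i * rsqrt_coeff (k - i)))"
      by (intro sum.cong refl) (simp add: c_def sum_distrib_left mult.commute)
    finally show ?thesis by (simp add: rsqrt_coeff_convolution)
  qed
  have fin: "finite {(i, j). i + j < n}" for n :: nat
    by (rule finite_subset[of _ "{..<n} \<times> {..<n}"]) auto
  have sq: "(rsqrt_poly m t)\<^sup>2 = sum c ({..<m} \<times> {..<m})"
    unfolding power2_eq_square rsqrt_poly_def sum_product sum.cartesian_product
    by (intro sum.cong refl) (auto simp: c_def power_add)
  have "sum c {(i, j). i + j < m} \<le> sum c ({..<m} \<times> {..<m})"
    by (intro sum_mono2) (auto simp: c_nonneg)
  then have lower: "(\<Sum>k<m. t ^ k) \<le> (rsqrt_poly m t)\<^sup>2" by (simp add: tri sq)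
  have "sum c ({..<m} \<times> {..<m}) \<le> sum c {(i, j). i + j < 2 * m}"
    by (intro sum_mono2 fin) (auto simp: c_nonneg)
  then have upper: "(rsqrt_poly m t)\<^sup>2 \<le> (\<Sum>k<2 * m. t ^ k)" by (simp add: tri sq)
  have geo: "(1 - t) * (\<Sum>k<n. t ^ k) = 1 - t ^ n" for n
    by (simp add: one_diff_power_eq)
  show "1 - t ^ m \<le> (1 - t) * (rsqrt_poly m t)\<^sup>2"
    using mult_left_mono[OF lower, of "1 - t"] t by (simp add: geo)
  show "(1 - t) * (rsqrt_poly m t)\<^sup>2 \<le> 1"
    using mult_left_mono[OF upper, of "1 - t"] t zero_le_power[OF t(1), of "2 * m"] unfolding geo by linarith
qed

text \<open>Multiplication by the sign \<open>u\<close> turns the error into \<open>1 - r\<close>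
  with \<open>0 \<le> r \<le> 1\<close>, and \<open>r \<ge> r ^ 2 \<ge> 1 - t ^ m\<close>.
  Describing \<open>u\<close> by \<open>u * y = \<bar>y\<bar>\<close> allows either sign at
  \<open>y = 0\<close>.\<close>

lemma sign_approx:
  fixes u y :: real
  assumes u: "\<bar>u\<bar> = 1" "u * y = \<bar>y\<bar>" and y: "\<bar>y\<bar> \<le> 1"
  shows "\<bar>u - y * rsqrt_poly m (1 - y\<^sup>2)\<bar> \<le> (1 - y\<^sup>2) ^ m"
    and "\<bar>y * rsqrt_poly m (1 - y\<^sup>2)\<bar> \<le> 1"
proof -
  define t where "t = 1 - y\<^sup>2"
  have t: "0 \<le> t" "t \<le> 1" using y abs_square_le_1[of y] by (auto simp: t_def)
  define r where "r = \<bar>y\<bar> * rsqrt_poly m t"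
  have r0: "0 \<le> r"
    unfolding r_def rsqrt_poly_def using t
    by (intro mult_nonneg_nonneg sum_nonneg) (auto simp: rsqrt_coeff_nonneg)
  have "r\<^sup>2 = (1 - t) * (rsqrt_poly m t)\<^sup>2" by (simp add: r_def t_def power_mult_distrib)
  then have sq: "1 - t ^ m \<le> r\<^sup>2" "r\<^sup>2 \<le> 1" using rsqrt_poly_sq_bounds[OF t] by auto
  have r1: "r \<le> 1" using sq(2) by (simp add: abs_square_le_1 r0)
  have "r\<^sup>2 \<le> r" using r0 r1 by (simp add: power2_eq_square mult_left_le)
  then have "1 - t ^ m \<le> r" using sq(1) by linarith
  moreover have "\<bar>u - y * rsqrt_poly m t\<bar> = \<bar>1 - r\<bar>"
  proof -
    have "u * u = 1" using u(1) by (simp add: abs_if split: if_splits)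
    have "u * (u - y * rsqrt_poly m t) = u * u - (u * y) * rsqrt_poly m t" by (simp add: algebra_simps)
    also have "\<dots> = 1 - r" by (simp only: \<open>u * u = 1\<close> u(2) r_def)
    finally have "\<bar>u\<bar> * \<bar>u - y * rsqrt_poly m t\<bar> = \<bar>1 - r\<bar>" by (simp only: abs_mult[symmetric])
    then show ?thesis using u(1) by simp
  qed
  ultimately show "\<bar>u - y * rsqrt_poly m (1 - y\<^sup>2)\<bar> \<le> (1 - y\<^sup>2) ^ m"
    using r1 by (simp add: t_def)
  have "\<bar>y * rsqrt_poly m t\<bar> = r"
    using r0 by (metis abs_abs abs_mult abs_of_nonneg r_def)
  then show "\<bar>y * rsqrt_poly m (1 - y\<^sup>2)\<bar> \<le> 1" using r1 by (simp add: t_def)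
qed

text \<open>The integer part contributes exactly the sign \<open>(- 1) ^ N\<close>, and the sine of
  \<open>pi\<close> times the fractional part is nonnegative.\<close>

lemma minus_one_power_floor_times_sin:
  fixes x :: real
  assumes "0 \<le> x"
  shows "(- 1) ^ nat \<lfloor>x\<rfloor> * sin (pi * x) = \<bar>sin (pi * x)\<bar>"
proof -
  define N where "N = nat \<lfloor>x\<rfloor>"
  define r where "r = x - real N"
  have N: "real N \<le> x" "x < real N + 1" using assms by (auto simp: N_def)
  have r: "0 \<le> r" "r < 1" using N by (auto simp: r_def)
  have "sin (pi * x) = sin (pi * r + pi * real N)" by (simp add: r_def algebra_simps)
  also have "\<dots> = (- 1) ^ N * sin (pi * r)" by (simp add: sin_add)
  finally have eq: "sin (pi * x) = (- 1) ^ N * sin (pi * r)" .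
  have "0 \<le> sin (pi * r)" using r by (intro sin_ge_zero) auto
  then show ?thesis
    unfolding N_def[symmetric] eq by (simp add: abs_mult power_abs mult.assoc[symmetric] flip: power_add)
qed

section \<open>Computability\<close>

definition recf_add :: recf where
  "recf_add = PrimRec (Proj 0) (Comp Succ [Proj 1])"

definition recf_mult :: recf where
  "recf_mult = PrimRec Zero (Comp recf_add [Proj 1, Proj 2])"

definition recf_pred :: recf where
  "recf_pred = PrimRec Zero (Proj 0)"

text \<open>Truncated subtraction with reversed arguments: the recursion runs over the first
  argument, which must therefore be the number subtracted.\<close>

definition recf_rsub :: recf where
  "recf_rsub = PrimRec (Proj 0) (Comp recf_pred [Proj 1])"

text \<open>Each step replaces the previous value \<open>r\<close> by \<open>1 - r\<close>.\<close>

definition recf_parity :: recf where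
  "recf_parity = PrimRec Zero (Comp recf_rsub [Proj 1, Comp Succ [Zero]])"

lemma evaluates_ProjI: "i < length xs \<Longrightarrow> xs ! i = y \<Longrightarrow> evaluates (Proj i) xs y"
  using evaluates.Proj by blast

text \<open>The equation for \<open>p\<close> keeps the recursive call folded, so that an induction
  hypothesis about the named function matches it.\<close>

lemma evaluates_PrimRec_SucI:
  "p = PrimRec f g \<Longrightarrow> evaluates p (n # xs) r \<Longrightarrow> evaluates g (n # r # xs) y
    \<Longrightarrow> evaluates p (Suc n # xs) y"
  by (simp add: PrimRec_Suc)

lemma evaluates_Comp1:
  "evaluates g xs y \<Longrightarrow> evaluates f [y] z \<Longrightarrow> evaluates (Comp f [g]) xs z"
  by (rule evaluates.Comp[where ys = "[y]"]) auto

lemma evaluates_Comp2: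
  "evaluates g xs y \<Longrightarrow> evaluates g' xs y' \<Longrightarrow> evaluates f [y, y'] z \<Longrightarrow> evaluates (Comp f [g, g']) xs z"
  by (rule evaluates.Comp[where ys = "[y, y']"]) auto

lemma evaluates_SuccI: "z = Suc x \<Longrightarrow> evaluates Succ [x] z"
  by (simp add: evaluates.Succ)

lemma evaluates_add: "z = x + y \<Longrightarrow> evaluates recf_add [x, y] z"
proof (induction x arbitrary: z)
  case 0
  then show ?case unfolding recf_add_def by (intro PrimRec_0 evaluates_ProjI) auto
next
  case (Suc x)
  show ?case
    by (rule evaluates_PrimRec_SucI[OF recf_add_def, where r = "x + y"])
      (use Suc in \<open>auto intro!: evaluates_Comp1[where y = "x + y"] evaluates_ProjI evaluates_SuccI\<close>)
qed

lemma evaluates_mult: "z = x * y \<Longrightarrow> evaluates recf_mult [x, y] z"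
proof (induction x arbitrary: z)
  case 0
  then show ?case unfolding recf_mult_def by (auto intro: PrimRec_0 evaluates.Zero)
next
  case (Suc x)
  show ?case
    by (rule evaluates_PrimRec_SucI[OF recf_mult_def, where r = "x * y"])
      (use Suc in \<open>auto
        intro!: evaluates_Comp2[where y = "x * y" and y' = y] evaluates_ProjI evaluates_add\<close>)
qed

lemma evaluates_pred: "z = x - 1 \<Longrightarrow> evaluates recf_pred [x] z"
proof (induction x arbitrary: z)
  case 0
  then show ?case unfolding recf_pred_def by (auto intro: PrimRec_0 evaluates.Zero)
next
  case (Suc x)
  show ?case
    by (rule evaluates_PrimRec_SucI[OF recf_pred_def, where r = "x - 1"])
      (use Suc in \<open>auto intro!: evaluates_ProjI\<close>)
qed

lemma evaluates_rsub: "z = y - x \<Longrightarrow> evaluates recf_rsub [x, y] z"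
proof (induction x arbitrary: z)
  case 0
  then show ?case unfolding recf_rsub_def by (intro PrimRec_0 evaluates_ProjI) auto
next
  case (Suc x)
  show ?case
    by (rule evaluates_PrimRec_SucI[OF recf_rsub_def, where r = "y - x"])
      (use Suc in \<open>auto
        intro!: evaluates_Comp1[where y = "y - x"] evaluates_ProjI evaluates_pred\<close>)
qed

lemma evaluates_parity: "z = x mod 2 \<Longrightarrow> evaluates recf_parity [x] z"
proof (induction x arbitrary: z)
  case 0
  then show ?case unfolding recf_parity_def by (auto intro: PrimRec_0 evaluates.Zero)
next
  case (Suc x)
  then have z: "z = 1 - x mod 2" by presburger
  show ?case
    by (rule evaluates_PrimRec_SucI[OF recf_parity_def, where r = "x mod 2"])
      (use Suc.IH in \<open>auto simp: z
        intro!: evaluates_Comp2[where y = "x mod 2" and y' = 1] evaluates_ProjI evaluates_rsub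
          evaluates_Comp1[where y = 0] evaluates.Zero evaluates_SuccI\<close>)
qed

text \<open>\<open>s n\<close> is the integer square root of \<open>8 * n ^ 6\<close>, the least
  \<open>m\<close> with \<open>8 * n ^ 6 < (Suc m) ^ 2\<close>, so minimization finds it.\<close>

lemma computable_parity_of_sqrt:
  assumes s: "\<And>n. (s n)\<^sup>2 \<le> 8 * n ^ 6" "\<And>n. 8 * n ^ 6 < (Suc (s n))\<^sup>2"
  shows "computable (\<lambda>n. s n mod 2)"
proof -
  define sq where "sq f = Comp recf_mult [f, f]" for f
  define dbl where "dbl f = Comp recf_add [f, f]" for f
  define bound where "bound = dbl (dbl (dbl (sq (Comp recf_mult [Proj 1, sq (Proj 1)]))))"
  \<comment> \<open>Truncated subtraction from the successor of the bound is zero exactly when the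
    strict inequality holds.\<close>
  define test where "test = Comp recf_rsub [sq (Comp Succ [Proj 0]), Comp Succ [bound]]"
  have sq: "evaluates (sq f) xs (y ^ 2)" if "evaluates f xs y" for f xs y
    unfolding sq_def using that by (rule evaluates_Comp2[OF _ that]) (simp add: evaluates_mult power2_eq_square)
  have dbl: "evaluates (dbl f) xs (2 * y)" if "evaluates f xs y" for f xs y
    unfolding dbl_def using that by (rule evaluates_Comp2[OF _ that]) (simp add: evaluates_add)
  have "evaluates bound [m, n] (2 * (2 * (2 * (n * n ^ 2) ^ 2)))" for m n
    unfolding bound_def
    by (intro dbl sq evaluates_Comp2[where y = n and y' = "n ^ 2"] evaluates_ProjI evaluates_mult) auto
  moreover have "2 * (2 * (2 * (n * n ^ 2) ^ 2)) = 8 * n ^ 6" for n :: nat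
    by (simp add: power2_eq_square eval_nat_numeral)
  ultimately have bound: "evaluates bound [m, n] (8 * n ^ 6)" for m n by simp
  have test: "evaluates test [m, n] (Suc (8 * n ^ 6) - (Suc m)\<^sup>2)" for m n
    unfolding test_def
    by (rule evaluates_Comp2[where y = "(Suc m)\<^sup>2" and y' = "Suc (8 * n ^ 6)"])
      (auto intro!: sq evaluates_Comp1[OF bound] evaluates_Comp1[where y = m] evaluates_ProjI
        evaluates_SuccI evaluates_rsub)
  have "evaluates (Mu test) [n] (s n)" for n
  proof (rule evaluates.Mu)
    show "evaluates test [s n, n] 0"
      using test[of "s n" n] s(2)[of n] by simp
    fix m assume "m < s n"
    then have "(Suc m)\<^sup>2 \<le> (s n)\<^sup>2" by (intro power_mono) auto
    also have "\<dots> \<le> 8 * n ^ 6" by (rule s)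
    finally have "Suc (8 * n ^ 6) - (Suc m)\<^sup>2 = Suc (8 * n ^ 6 - (Suc m)\<^sup>2)" by simp
    then show "\<exists>y. evaluates test [m, n] (Suc y)" using test[of m n] by metis
  qed
  then have "evaluates (Comp recf_parity [Mu test]) [n] (s n mod 2)" for n
    by (rule evaluates_Comp1) (simp add: evaluates_parity)
  then show ?thesis unfolding computable_def by blast
qed

section \<open>Correlation of adjacent intervals\<close>

lemma odd_trig_poly_sin_times_rsqrt_poly:
  "odd_trig_poly (\<lambda>x. complex_of_real (sin x * rsqrt_poly m (1 - (sin x)\<^sup>2)))"
proof -
  have "odd_trig_poly (\<lambda>x. \<Sum>j<m. of_real (rsqrt_coeff j) * complex_of_real (sin x * (cos x ^ 2) ^ j))"
    by (intro odd_trig_poly_sum odd_trig_poly_cmult odd_trig_poly_sin_times_cos_power)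
  moreover have "(\<Sum>j<m. of_real (rsqrt_coeff j) * complex_of_real (sin x * (cos x ^ 2) ^ j))
      = complex_of_real (sin x * rsqrt_poly m (1 - (sin x)\<^sup>2))" for x
    by (simp add: rsqrt_poly_def sum_distrib_left cos_squared_eq mult.left_commute)
  ultimately show ?thesis by simp
qed

lemma eventually_sign_correlation_le:
  fixes u :: "nat \<Rightarrow> real" and \<epsilon> :: real
  assumes u: "\<And>k. \<bar>u k\<bar> = 1" "\<And>k. u k * sin (phase k) = \<bar>sin (phase k)\<bar>" and "\<epsilon> > 0"
  shows "\<forall>\<^sub>F n in sequentially. \<forall>k. (\<Sum>i<n. u (k + i) * u (k + n + i)) \<le> 2 * \<epsilon> * real n"
proof -
  \<comment> \<open>The mean of \<open>W\<close> is at most \<open>\<epsilon> / 4\<close> and its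
    deviation another \<open>\<epsilon> / 4\<close>, so the two windows cost
    \<open>\<epsilon>\<close> together; the product of the polynomials costs the other
    \<open>\<epsilon>\<close>.\<close>
  obtain m where m: "real (2 * m choose m) / 4 ^ m \<le> \<epsilon> / 4"
    using central_binomial_quotient_small[of "\<epsilon> / 4"] \<open>\<epsilon> > 0\<close> by auto
  define c where "c = real (2 * m choose m) / 4 ^ m"
  define v where "v = (\<lambda>x. sin x * rsqrt_poly m (1 - (sin x)\<^sup>2))"
  define W where "W = (\<lambda>k. (cos (phase k) ^ 2) ^ m)"
  have W: "(1 - (sin (phase k))\<^sup>2) ^ m = W k" for k by (simp add: W_def cos_squared_eq)
  have err: "\<bar>u k - v (phase k)\<bar> \<le> W k" and v1: "\<bar>v (phase k)\<bar> \<le> 1" for k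
    using sign_approx[of "u k" "sin (phase k)" m] u unfolding v_def W by auto
  have vv: "\<forall>\<^sub>F n in sequentially. \<forall>k.
      norm (\<Sum>i<n. complex_of_real (v (phase (k + i))) * complex_of_real (v (phase (k + n + i)))) \<le> \<epsilon> * real n"
    using has_null_averages_odd_trig_poly_product[OF
        odd_trig_poly_sin_times_rsqrt_poly[of m] odd_trig_poly_sin_times_rsqrt_poly[of m]] \<open>\<epsilon> > 0\<close>
    unfolding v_def has_null_averages_def by blast
  have "\<epsilon> / 4 > 0" using \<open>\<epsilon> > 0\<close> by simp
  then have WW: "\<forall>\<^sub>F n in sequentially. \<forall>k. norm (\<Sum>i<n. complex_of_real (W (k + i) - c)) \<le> \<epsilon> / 4 * real n"
    using has_null_averages_cos_power_minus_mean[of m]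
    unfolding W_def c_def has_null_averages_def by blast
  from vv WW show ?thesis
  proof eventually_elim
    case (elim n)
    have sumW: "(\<Sum>i<n. W (k + i)) \<le> \<epsilon> / 2 * real n" for k
    proof -
      have "(\<Sum>i<n. W (k + i) - c) \<le> norm (complex_of_real (\<Sum>i<n. W (k + i) - c))"
        by (simp only: norm_of_real abs_ge_self)
      also have "\<dots> \<le> \<epsilon> / 4 * real n" using elim(2) by (simp only: of_real_sum)
      finally have "(\<Sum>i<n. W (k + i)) \<le> real n * c + \<epsilon> / 4 * real n" by (simp add: sum_subtractf)
      moreover have "real n * c \<le> real n * (\<epsilon> / 4)" using m by (intro mult_left_mono) (auto simp: c_def)
      ultimately show ?thesis by (simp add: algebra_simps)
    qed
    show ?case
    proof
      fix k
      \<comment> \<open>The signs are exchanged for the polynomial one factor at a time, each time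
        beside a factor bounded by 1.\<close>
      have pointwise: "u (k + i) * u (k + n + i)
          \<le> v (phase (k + i)) * v (phase (k + n + i)) + (W (k + i) + W (k + n + i))" for i
      proof -
        define p p' q q' where "p = u (k + i)" and "p' = u (k + n + i)"
          and "q = v (phase (k + i))" and "q' = v (phase (k + n + i))"
        have "\<bar>p * p' - q * q'\<bar> = \<bar>(p - q) * p' + q * (p' - q')\<bar>" by (simp add: algebra_simps)
        also have "\<dots> \<le> \<bar>p - q\<bar> * \<bar>p'\<bar> + \<bar>q\<bar> * \<bar>p' - q'\<bar>"
          unfolding abs_mult[symmetric] by (rule abs_triangle_ineq)
        also have "\<dots> \<le> W (k + i) * 1 + 1 * W (k + n + i)"
          using err[of "k + i"] err[of "k + n + i"] v1[of "k + i"] u(1)[of "k + n + i"]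
          by (intro add_mono mult_mono) (auto simp: p_def p'_def q_def q'_def W_def)
        finally show ?thesis unfolding p_def p'_def q_def q'_def by linarith
      qed
      have "(\<Sum>i<n. u (k + i) * u (k + n + i))
          \<le> (\<Sum>i<n. v (phase (k + i)) * v (phase (k + n + i)) + (W (k + i) + W (k + n + i)))"
        by (intro sum_mono pointwise)
      also have "\<dots> = (\<Sum>i<n. v (phase (k + i)) * v (phase (k + n + i)))
          + ((\<Sum>i<n. W (k + i)) + (\<Sum>i<n. W (k + n + i)))"
        by (simp only: sum.distrib)
      also have "(\<Sum>i<n. v (phase (k + i)) * v (phase (k + n + i)))
          \<le> norm (complex_of_real (\<Sum>i<n. v (phase (k + i)) * v (phase (k + n + i))))"
        by (simp only: norm_of_real abs_ge_self)
      also have "\<dots> \<le> \<epsilon> * real n" using elim(1) by (simp only: of_real_sum of_real_mult)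
      finally show "(\<Sum>i<n. u (k + i) * u (k + n + i)) \<le> 2 * \<epsilon> * real n"
        using sumW[of k] sumW[of "k + n"] by (simp add: algebra_simps)
    qed
  qed
qed

theorem theorem5p4:
  fixes \<epsilon> :: real
  assumes "\<epsilon> > 0"
  shows "\<exists>(N::nat) (a::nat \<Rightarrow> nat).
           computable a \<and> (\<forall>k\<ge>1. a k \<in> {0, 1}) \<and>
           (\<forall>k\<ge>1. \<forall>n>N.
              real (card {i. i < n \<and> a (k + i) \<noteq> a (k + n + i)}) \<ge> (1/2 - \<epsilon>) * real n)"
proof -
  define \<theta> where "\<theta> k = 2 * sqrt 2 * real k ^ 3" for k :: nat
  define s where "s k = nat \<lfloor>\<theta> k\<rfloor>" for k
  define u where "u k = (- 1 :: real) ^ s k" for k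
  have \<theta>: "0 \<le> \<theta> k" for k by (simp add: \<theta>_def)
  have \<theta>_sq: "(\<theta> k)\<^sup>2 = real (8 * k ^ 6)" for k
    by (simp add: \<theta>_def power_mult_distrib flip: power_mult)
  have comp: "computable (\<lambda>k. s k mod 2)"
  proof (rule computable_parity_of_sqrt)
    fix k
    have "real (s k) = of_int \<lfloor>\<theta> k\<rfloor>" using \<theta>[of k] by (simp add: s_def)
    then have s: "real (s k) \<le> \<theta> k" "\<theta> k < real (Suc (s k))" by linarith+
    have "(real (s k))\<^sup>2 \<le> (\<theta> k)\<^sup>2" using s by (intro power_mono) auto
    then show "(s k)\<^sup>2 \<le> 8 * k ^ 6" unfolding \<theta>_sq by (simp only: of_nat_power[symmetric] of_nat_le_iff)
    have "(\<theta> k)\<^sup>2 < (real (Suc (s k)))\<^sup>2" using s \<theta>[of k] by (intro power_strict_mono) auto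
    then show "8 * k ^ 6 < (Suc (s k))\<^sup>2" unfolding \<theta>_sq by (simp only: of_nat_power[symmetric] of_nat_less_iff)
  qed
  have "\<bar>u k\<bar> = 1" "u k * sin (phase k) = \<bar>sin (phase k)\<bar>" for k
    using minus_one_power_floor_times_sin[OF \<theta>[of k]] by (simp_all add: u_def s_def \<theta>_def phase_def)
  from eventually_sign_correlation_le[of u, OF this assms]
  obtain N where N: "\<And>n k. n \<ge> N \<Longrightarrow> (\<Sum>i<n. u (k + i) * u (k + n + i)) \<le> 2 * \<epsilon> * real n"
    unfolding eventually_sequentially by blast
  have "(1 / 2 - \<epsilon>) * real n \<le> real (card {i. i < n \<and> s (k + i) mod 2 \<noteq> s (k + n + i) mod 2})"
    if "n > N" for n k
  proof -
    \<comment> \<open>A product of signs is -1 exactly at a disagreement, so the correlation is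
      \<open>n\<close> minus twice the number of disagreements; its bound
      \<open>2 * \<epsilon> * n\<close> halves to the claimed loss.\<close>
    have "u (k + i) * u (k + n + i) = 1 - 2 * of_bool (s (k + i) mod 2 \<noteq> s (k + n + i) mod 2)" for i
      by (auto simp: u_def minus_one_power_iff mod2_eq_if)
    then have "(\<Sum>i<n. u (k + i) * u (k + n + i))
        = real n - 2 * (\<Sum>i<n. of_bool (s (k + i) mod 2 \<noteq> s (k + n + i) mod 2))"
      by (simp only: sum_subtractf sum_distrib_left) simp
    also have "(\<Sum>i<n. of_bool (s (k + i) mod 2 \<noteq> s (k + n + i) mod 2))
        = real (card {i. i < n \<and> s (k + i) mod 2 \<noteq> s (k + n + i) mod 2})"
      by (simp add: Int_def)
    finally show ?thesis using N[of n k] that by (simp add: algebra_simps)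
  qed
  then show ?thesis using comp by (intro exI[of _ N] exI[of _ "\<lambda>k. s k mod 2"]) auto
qed

end
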